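(* Let $N\ge1$, $K\in T(M)$, and let $\hat u_N=\sum_{i=0}^N\varepsilon^i\eta_i$. Let $\hat\eta_{Nt}=\hat K_N(\hat\eta_N)$, i.e. $\eta_{it}=\frac1{i!}\left.\frac{\partial^iK(\hat u_N)}{\partial\varepsilon^i}\right|_{\varepsilon=0}$, $0\le i\le N$, be the $N$-th order perturbation equation of $u_t=K(u)$. If $u_t=K(u)$ possesses a Hamiltonian structure $$u_t=K(u)=J(u)\frac{\delta H(u)}{\delta u},$$ where $J:T^*(M)\to T(M)$ is a Hamiltonian operator and $H\in C^\infty(M)$, then the perturbation equation also possesses a Hamiltonian structure $$\hat\eta_{Nt}=\hat K_N(\hat\eta_N)=\hat J_N(\hat\eta_N)\frac{\delta\hat H_N(\hat\eta_N)}{\delta\hat\eta_N},$$ where the Hamiltonian operator $\hat J_N$ is $$\hat{J}_N(\hat{\eta}_N)=\left[\frac{1}{(i+j-N)!}\left.\frac{\partial^{i+j-N}J(\hat u_N)}{\partial\varepsilon^{i+j-N}}\right|_{\varepsilon=0}\right]_{i,j=0,1,\dots,N}\quad(\text{blocks with } i+j<N\text{ are zero})$$ and the Hamiltonian function $\hat H_N\in C^\infty(\hat M_N)$ is $$\hat H_N(\hat\eta_N)=\frac1{N!}\left.\frac{\partial^NH(\hat u_N)}{\partial\varepsilon^N}\right|_{\varepsilon=0}.$$ The corresponding Poisson bracket has the property $$\{\hat H_{1N},\hat H_{2N}\}_{\hat J_N}(\hat\eta_N)=\frac1{N!}\left.\frac{\partial^N}{\partial\varepsilon^N}\right|_{\varepsilon=0}\{H_1,H_2\}_J(\hat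 u_N),\qquad H_1,H_2\in C^\infty(M),$$ where $\hat H_{kN}(\hat\eta_N)=\frac1{N!}\left.\frac{\partial^NH_k(\hat u_N)}{\partial\varepsilon^N}\right|_{\varepsilon=0}$. Furthermore, the perturbation equation possesses a multi-Hamiltonian structure $$\hat\eta_{Nt}=\hat K_N(\hat\eta_N)=\hat J_{1N}(\hat\eta_N)\frac{\delta\hat H_{1N}(\hat\eta_N)}{\delta\hat\eta_N}=\cdots=\hat J_{mN}(\hat\eta_N)\frac{\delta\hat H_{mN}(\hat\eta_N)}{\delta\hat\eta_N}$$ once $u_t=K(u)$ possesses an analogous multi-Hamiltonian structure $$u_t=K(u)=J_1(u)\frac{\delta H_1(u)}{\delta u}=\cdots=J_m(u)\frac{\delta H_m(u)}{\delta u},$$ where $\hat J_{kN}$ and $\hat H_{kN}$ are obtained from $J_k$ and $H_k$ by the same formulas as $\hat J_N$ and $\hat H_N$ from $J$ and $H$.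
   Context: Setting. $M=M(u)$ is a manifold with variable $u$, a column vector with $q$ components (typically functions); it is treated as a linear space, so that $u+\varepsilon S$ makes sense, tangent vectors at all points lie in one fixed space $E$ and cotangent vectors in one fixed space $E^*$, with a nondegenerate duality pairing $\langle\cdot,\cdot\rangle$ between cotangent and tangent vectors. $\hat M_N=\hat M_N(\hat\eta_N)$ is the analogous manifold with variable $\hat\eta_N=(\eta_0^T,\dots,\eta_N^T)^T$, each $\eta_i$ being of the same kind and dimension as $u$; its tangent (cotangent) vectors are $(N+1)$-tuples of elements of $E$ (of $E^*$), the pairing is the sum of the componentwise pairings, and operators are $(N+1)\times(N+1)$ block matrices. $T(\cdot)$, $T^*(\cdot)$ denote tangent and cotangent bundles (membership means being a field) and $C^\infty(\cdot)$ smooth functions. All objects are assumed smooth, with as many derivatives as needed. Gateaux derivative: $X'(u)[S(u)]=\left.\frac{\partial}{\partial\varepsilon}X(u+\varepsilon S(u))\right|_{\varepsilon=0}$. Variational derivative: for $H\in C^\infty(M)$, $\frac{\delta H}{\delta u}\in T^*(M)$ is the cotangent field with $\langle\frac{\delta H}{\delta u}(u),K(u)\rangle=H'(u)[K(u)]$ for all $K\in T(M)$ (assumed to exist for the functions considered on $M$). A linear operator $J:T^*(M)\to T(M)$ is Hamiltonian if it is skew-symmetric, $\langle\alpha,J\beta\rangle=-\langle\beta,J\alpha\rangle$, and for all $\alpha,\beta,\gamma\in T^*(M)$ $$\langle\alpha(u),J'(u)[J(u)\beta(u)]\gamma(u)\rangle+\mathrm{cycle}(\alpha,\beta,\gamma)=0$$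 (sum over cyclic permutations). Its Poisson bracket is $\{H_1,H_2\}_J(u)=\langle\frac{\delta H_1}{\delta u}(u),J(u)\frac{\delta H_2}{\delta u}(u)\rangle$. Two operators $J,J':T^*(M)\to T(M)$ form a Hamiltonian pair if $J+cJ'$ is Hamiltonian for every constant $c$. A multi-Hamiltonian structure is a family of representations as displayed in which all the operators are Hamiltonian and any two of them form a Hamiltonian pair. The same definitions apply on $\hat M_N$. *)

theory Defs
  imports "HOL-Analysis.Analysis"
begin

section \<open>Locally convex spaces\<close>

text \<open>
  The model spaces of tangent and cotangent vectors are Hausdorff locally convex real topological
  vector spaces.  Normed spaces are too narrow here: typical vector fields are differential
  operators, which map smooth functions to smooth functions but do not preserve a space of
  functions of finite differentiability.
\<close>

class locally_convex_space = real_vector + topological_ab_group_add + t2_space +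
  assumes tendsto_scaleR_nhds: "((\<lambda>p. fst p *\<^sub>R snd p) \<longlongrightarrow> r *\<^sub>R x) (nhds r \<times>\<^sub>F nhds x)"
    and convex_nhds: "open U \<Longrightarrow> x \<in> U \<Longrightarrow> \<exists>C. open C \<and>
      (\<forall>y\<in>C. \<forall>z\<in>C. \<forall>a\<ge>0. \<forall>b\<ge>0. a + b = 1 \<longrightarrow> a *\<^sub>R y + b *\<^sub>R z \<in> C) \<and> x \<in> C \<and> C \<subseteq> U"

lemma convex_nhds_base:
  fixes x :: "'a::locally_convex_space"
  shows "open U \<Longrightarrow> x \<in> U \<Longrightarrow> \<exists>C. open C \<and> convex C \<and> x \<in> C \<and> C \<subseteq> U"
  unfolding convex_def by (rule convex_nhds)

instance real_normed_vector \<subseteq> locally_convex_space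
proof
  fix r :: real and x :: 'a
  show "((\<lambda>p. fst p *\<^sub>R snd p) \<longlongrightarrow> r *\<^sub>R x) (nhds r \<times>\<^sub>F nhds x)"
    by (rule tendsto_scaleR[OF filterlim_fst filterlim_snd])
next
  fix U :: "'a set" and x
  assume "open U" "x \<in> U"
  then obtain e where "e > 0" "ball x e \<subseteq> U"
    using open_contains_ball by blast
  then show "\<exists>C. open C \<and>
      (\<forall>y\<in>C. \<forall>z\<in>C. \<forall>a\<ge>0. \<forall>b\<ge>0. a + b = 1 \<longrightarrow> a *\<^sub>R y + b *\<^sub>R z \<in> C) \<and> x \<in> C \<and> C \<subseteq> U"
    unfolding convex_def[symmetric]
    by (intro exI[of _ "ball x e"]) auto
qed

instance prod :: (topological_monoid_add, topological_monoid_add) topological_monoid_add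
proof
  fix a b :: "'a \<times> 'b"
  have 1: "filterlim fst (nhds a) (nhds a \<times>\<^sub>F nhds b)" and 2: "filterlim snd (nhds b) (nhds a \<times>\<^sub>F nhds b)"
    by (rule filterlim_fst, rule filterlim_snd)
  show "LIM x (nhds a \<times>\<^sub>F nhds b). fst x + snd x :> nhds (a + b)"
    unfolding plus_prod_def
    by (rule tendsto_Pair[OF tendsto_add[OF tendsto_fst[OF 1] tendsto_fst[OF 2]]
          tendsto_add[OF tendsto_snd[OF 1] tendsto_snd[OF 2]]])
qed

instance prod :: (topological_comm_monoid_add, topological_comm_monoid_add) topological_comm_monoid_add ..

instance prod :: (topological_group_add, topological_group_add) topological_group_add
proof
  fix a :: "'a \<times> 'b"
  show "(uminus \<longlongrightarrow> - a) (nhds a)"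
    unfolding uminus_prod_def
    by (rule tendsto_Pair[OF tendsto_minus[OF tendsto_fst[OF filterlim_ident]]
          tendsto_minus[OF tendsto_snd[OF filterlim_ident]]])
qed

instance prod :: (topological_ab_group_add, topological_ab_group_add) topological_ab_group_add ..

instance prod :: (locally_convex_space, locally_convex_space) locally_convex_space
proof
  fix r :: real and x :: "'a \<times> 'b"
  have 1: "filterlim fst (nhds r) (nhds r \<times>\<^sub>F nhds x)" and 2: "filterlim snd (nhds x) (nhds r \<times>\<^sub>F nhds x)"
    by (rule filterlim_fst, rule filterlim_snd)
  have "filterlim (\<lambda>p. (fst p, fst (snd p))) (nhds r \<times>\<^sub>F nhds (fst x)) (nhds r \<times>\<^sub>F nhds x)"
    by (subst nhds_prod[symmetric], rule tendsto_Pair[OF 1 tendsto_fst[OF 2]])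
  from filterlim_compose[OF tendsto_scaleR_nhds this]
  have a: "((\<lambda>p. fst p *\<^sub>R fst (snd p)) \<longlongrightarrow> r *\<^sub>R fst x) (nhds r \<times>\<^sub>F nhds x)" by simp
  have "filterlim (\<lambda>p. (fst p, snd (snd p))) (nhds r \<times>\<^sub>F nhds (snd x)) (nhds r \<times>\<^sub>F nhds x)"
    by (subst nhds_prod[symmetric], rule tendsto_Pair[OF 1 tendsto_snd[OF 2]])
  from filterlim_compose[OF tendsto_scaleR_nhds this]
  have b: "((\<lambda>p. fst p *\<^sub>R snd (snd p)) \<longlongrightarrow> r *\<^sub>R snd x) (nhds r \<times>\<^sub>F nhds x)" by simp
  show "((\<lambda>p. fst p *\<^sub>R snd p) \<longlongrightarrow> r *\<^sub>R x) (nhds r \<times>\<^sub>F nhds x)"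
    unfolding scaleR_prod_def by (rule tendsto_Pair[OF a b])
next
  fix U :: "('a \<times> 'b) set" and x
  assume "open U" "x \<in> U"
  then obtain A B where AB: "open A" "open B" "x \<in> A \<times> B" "A \<times> B \<subseteq> U"
    by (rule open_prod_elim)
  obtain C where C: "open C" "convex C" "fst x \<in> C" "C \<subseteq> A"
    using convex_nhds_base[of A "fst x"] AB by (auto simp: mem_Times_iff)
  obtain D where D: "open D" "convex D" "snd x \<in> D" "D \<subseteq> B"
    using convex_nhds_base[of B "snd x"] AB by (auto simp: mem_Times_iff)
  show "\<exists>C. open C \<and>
      (\<forall>y\<in>C. \<forall>z\<in>C. \<forall>a\<ge>0. \<forall>b\<ge>0. a + b = 1 \<longrightarrow> a *\<^sub>R y + b *\<^sub>R z \<in> C) \<and> x \<in> C \<and> C \<subseteq> U"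
    unfolding convex_def[symmetric]
  proof (intro exI[of _ "C \<times> D"] conjI)
    show "open (C \<times> D)" using C D by (intro open_Times)
    show "convex (C \<times> D)" using C D by (intro convex_Times)
    show "x \<in> C \<times> D" using C D by (simp add: mem_Times_iff)
    show "C \<times> D \<subseteq> U" using AB C D by blast
  qed
qed

instance vec :: (t0_space, finite) t0_space
proof
  fix x y :: "'a ^ 'b"
  assume "x \<noteq> y"
  then obtain i where "x $ i \<noteq> y $ i" by (metis vec_eq_iff)
  then obtain U where U: "open U" "(x $ i \<in> U) \<noteq> (y $ i \<in> U)"
    by (metis separation_t0)
  show "\<exists>U. open U \<and> \<not> (x \<in> U \<longleftrightarrow> y \<in> U)"
  proof (intro exI conjI)
    show "open ((\<lambda>z. z $ i) -` U)" by (rule open_vimage_vec_nth[OF U(1)])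
    show "\<not> (x \<in> (\<lambda>z. z $ i) -` U \<longleftrightarrow> y \<in> (\<lambda>z. z $ i) -` U)" using U(2) by simp
  qed
qed

instance vec :: (t1_space, finite) t1_space
proof
  fix x y :: "'a ^ 'b"
  assume "x \<noteq> y"
  then obtain i where "x $ i \<noteq> y $ i" by (metis vec_eq_iff)
  then obtain U where U: "open U" "x $ i \<in> U" "y $ i \<notin> U"
    using t1_space by blast
  show "\<exists>U. open U \<and> x \<in> U \<and> y \<notin> U"
  proof (intro exI conjI)
    show "open ((\<lambda>z. z $ i) -` U)" by (rule open_vimage_vec_nth[OF U(1)])
    show "x \<in> (\<lambda>z. z $ i) -` U" "y \<notin> (\<lambda>z. z $ i) -` U" using U(2,3) by simp_all
  qed
qed

instance vec :: (t2_space, finite) t2_space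
proof
  fix x y :: "'a ^ 'b"
  assume "x \<noteq> y"
  then obtain i where "x $ i \<noteq> y $ i" by (metis vec_eq_iff)
  then obtain U V where UV: "open U" "open V" "x $ i \<in> U" "y $ i \<in> V" "U \<inter> V = {}"
    by (metis hausdorff)
  show "\<exists>U V. open U \<and> open V \<and> x \<in> U \<and> y \<in> V \<and> U \<inter> V = {}"
  proof (intro exI conjI)
    show "open ((\<lambda>z. z $ i) -` U)" "open ((\<lambda>z. z $ i) -` V)"
      by (rule open_vimage_vec_nth[OF UV(1)], rule open_vimage_vec_nth[OF UV(2)])
    show "x \<in> (\<lambda>z. z $ i) -` U" "y \<in> (\<lambda>z. z $ i) -` V" using UV(3,4) by simp_all
    show "(\<lambda>z. z $ i) -` U \<inter> (\<lambda>z. z $ i) -` V = {}" using UV(5) by blast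
  qed
qed

instance vec :: (topological_monoid_add, finite) topological_monoid_add
proof
  fix a b :: "'a ^ 'b"
  have 1: "filterlim fst (nhds a) (nhds a \<times>\<^sub>F nhds b)" and 2: "filterlim snd (nhds b) (nhds a \<times>\<^sub>F nhds b)"
    by (rule filterlim_fst, rule filterlim_snd)
  show "LIM x (nhds a \<times>\<^sub>F nhds b). fst x + snd x :> nhds (a + b)"
    by (rule vec_tendstoI) (simp, rule tendsto_add[OF tendsto_vec_nth[OF 1] tendsto_vec_nth[OF 2]])
qed

instance vec :: (topological_comm_monoid_add, finite) topological_comm_monoid_add ..

instance vec :: (topological_group_add, finite) topological_group_add
proof
  fix a :: "'a ^ 'b"
  show "(uminus \<longlongrightarrow> - a) (nhds a)"
    by (rule vec_tendstoI) (simp, rule tendsto_minus[OF tendsto_vec_nth[OF filterlim_ident]])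
qed

instance vec :: (topological_ab_group_add, finite) topological_ab_group_add ..

instance vec :: (locally_convex_space, finite) locally_convex_space
proof
  fix r :: real and x :: "'a ^ 'b"
  have 1: "filterlim fst (nhds r) (nhds r \<times>\<^sub>F nhds x)" and 2: "filterlim snd (nhds x) (nhds r \<times>\<^sub>F nhds x)"
    by (rule filterlim_fst, rule filterlim_snd)
  show "((\<lambda>p. fst p *\<^sub>R snd p) \<longlongrightarrow> r *\<^sub>R x) (nhds r \<times>\<^sub>F nhds x)"
  proof (rule vec_tendstoI)
    fix i
    have "filterlim (\<lambda>p. (fst p, snd p $ i)) (nhds r \<times>\<^sub>F nhds (x $ i)) (nhds r \<times>\<^sub>F nhds x)"
      by (subst nhds_prod[symmetric], rule tendsto_Pair[OF 1 tendsto_vec_nth[OF 2]])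
    from filterlim_compose[OF tendsto_scaleR_nhds this]
    show "((\<lambda>p. (fst p *\<^sub>R snd p) $ i) \<longlongrightarrow> (r *\<^sub>R x) $ i) (nhds r \<times>\<^sub>F nhds x)" by simp
  qed
next
  fix U :: "('a ^ 'b) set" and x
  assume "open U" "x \<in> U"
  then obtain A where A: "\<And>i. open (A i)" "\<And>i. x $ i \<in> A i" "\<And>y. (\<forall>i. y $ i \<in> A i) \<Longrightarrow> y \<in> U"
    unfolding open_vec_def by metis
  have "\<forall>i. \<exists>C. open C \<and> convex C \<and> x $ i \<in> C \<and> C \<subseteq> A i"
    using A convex_nhds_base by blast
  then obtain C where C: "\<And>i. open (C i)" "\<And>i. convex (C i)" "\<And>i. x $ i \<in> C i" "\<And>i. C i \<subseteq> A i"
    by metis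
  have "convex {y. \<forall>i. y $ i \<in> C i}"
    using C(2) unfolding convex_def by simp
  then show "\<exists>C. open C \<and>
      (\<forall>y\<in>C. \<forall>z\<in>C. \<forall>a\<ge>0. \<forall>b\<ge>0. a + b = 1 \<longrightarrow> a *\<^sub>R y + b *\<^sub>R z \<in> C) \<and> x \<in> C \<and> C \<subseteq> U"
    unfolding convex_def[symmetric]
  proof (intro exI[of _ "{y. \<forall>i. y $ i \<in> C i}"] conjI)
    show "open {y. \<forall>i. y $ i \<in> C i}" using C(1) by (simp add: open_vector_box)
    show "x \<in> {y. \<forall>i. y $ i \<in> C i}" using C(3) by simp
    show "{y. \<forall>i. y $ i \<in> C i} \<subseteq> U" using A(3) C(4) by blast
  qed
qed

section \<open>Differential calculus\<close>

definition has_curve_deriv :: "(real \<Rightarrow> 'a::locally_convex_space) \<Rightarrow> 'a \<Rightarrow> real \<Rightarrow> bool" where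
  "has_curve_deriv c d t \<longleftrightarrow> ((\<lambda>h. (1 / h) *\<^sub>R (c (t + h) - c t)) \<longlongrightarrow> d) (at 0)"

definition curve_deriv :: "(real \<Rightarrow> 'a::locally_convex_space) \<Rightarrow> real \<Rightarrow> 'a" where
  "curve_deriv c t = Lim (at 0) (\<lambda>h. (1 / h) *\<^sub>R (c (t + h) - c t))"

text \<open>On normed spaces this is the derivative of the library.\<close>

lemma has_curve_deriv_iff_has_vector_derivative:
  fixes c :: "real \<Rightarrow> 'a::real_normed_vector"
  shows "has_curve_deriv c d t \<longleftrightarrow> (c has_vector_derivative d) (at t)"
proof -
  have "(c has_vector_derivative d) (at t) \<longleftrightarrow>
      ((\<lambda>h. norm (c (t + h) - c t - h *\<^sub>R d) / norm h) \<longlongrightarrow> 0) (at 0)"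
    unfolding has_vector_derivative_def has_derivative_at
    by (simp add: bounded_linear_scaleR_left)
  also have "\<dots> \<longleftrightarrow> ((\<lambda>h. norm ((1 / h) *\<^sub>R (c (t + h) - c t) - d)) \<longlongrightarrow> 0) (at 0)"
  proof (rule filterlim_cong[OF refl refl])
    have "norm (c (t + h) - c t - h *\<^sub>R d) / norm h = norm ((1 / h) *\<^sub>R (c (t + h) - c t) - d)"
      if "h \<noteq> 0" for h
    proof -
      have "(1 / h) *\<^sub>R (c (t + h) - c t) - d = (1 / h) *\<^sub>R (c (t + h) - c t - h *\<^sub>R d)"
        using that by (simp add: scaleR_diff_right)
      then show ?thesis by simp
    qed
    then show "\<forall>\<^sub>F h in at 0. norm (c (t + h) - c t - h *\<^sub>R d) / norm h
        = norm ((1 / h) *\<^sub>R (c (t + h) - c t) - d)"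
      unfolding eventually_at_filter by (intro always_eventually) blast
  qed
  also have "\<dots> \<longleftrightarrow> has_curve_deriv c d t"
    unfolding has_curve_deriv_def tendsto_norm_zero_iff LIM_zero_iff ..
  finally show ?thesis ..
qed

lemma has_curve_deriv_imp_curve_deriv: "has_curve_deriv c d t \<Longrightarrow> curve_deriv c t = d"
  unfolding has_curve_deriv_def curve_deriv_def by (rule tendsto_Lim) simp_all

text \<open>
  Smoothness is smoothness along finite-dimensional families: a map is smooth if it sends smooth
  maps defined on some \<open>\<real>\<^sup>n\<close> to smooth maps.  Between Frechet spaces this is the usual notion
  (all iterated Gateaux derivatives exist and are jointly continuous), and between Banach spaces it is
  the existence of Frechet derivatives of all orders.  A function on \<open>\<real>\<^sup>n\<close> is
  represented by a function on sequences that only depends on the coordinates \<open>0, \<dots>, n - 1\<close>.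
\<close>

definition partial_deriv ::
    "nat \<Rightarrow> ((nat \<Rightarrow> real) \<Rightarrow> 'a::locally_convex_space) \<Rightarrow> (nat \<Rightarrow> real) \<Rightarrow> 'a" where
  "partial_deriv i p t = curve_deriv (\<lambda>s. p (t(i := s))) (t i)"

definition smooth_plot :: "nat \<Rightarrow> ((nat \<Rightarrow> real) \<Rightarrow> 'a::locally_convex_space) \<Rightarrow> bool" where
  "smooth_plot n p \<longleftrightarrow>
     (\<forall>s t. (\<forall>i<n. s i = t i) \<longrightarrow> p s = p t) \<and>
     (\<forall>is. set is \<subseteq> {..<n} \<longrightarrow>
        continuous_on UNIV (foldr partial_deriv is p) \<and>
        (\<forall>i<n. \<forall>t. \<exists>d. has_curve_deriv (\<lambda>s. foldr partial_deriv is p (t(i := s))) d (t i)))"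

definition smooth :: "('a::locally_convex_space \<Rightarrow> 'b::locally_convex_space) \<Rightarrow> bool" where
  "smooth X \<longleftrightarrow> (\<forall>n p. smooth_plot n p \<longrightarrow> smooth_plot n (X \<circ> p))"

definition gateaux ::
    "('a::locally_convex_space \<Rightarrow> 'b::locally_convex_space) \<Rightarrow> 'a \<Rightarrow> 'a \<Rightarrow> 'b" where
  "gateaux X u S = curve_deriv (\<lambda>\<epsilon>. X (u + \<epsilon> *\<^sub>R S)) 0"

section \<open>Hamiltonian structures\<close>

text \<open>
  The manifold is the whole of \<open>'e\<close>, so a tangent field is a smooth map from \<open>'e\<close> to \<open>'e\<close> and a
  cotangent field a smooth map from \<open>'e\<close> to \<open>'d\<close>.  Like all other objects, the pairing is smooth.
\<close>

definition duality_pairing ::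
    "('d::locally_convex_space \<Rightarrow> 'e::locally_convex_space \<Rightarrow> real) \<Rightarrow> bool" where
  "duality_pairing B \<longleftrightarrow>
     bilinear B \<and> smooth (\<lambda>(\<alpha>, x). B \<alpha> x) \<and>
     (\<forall>\<alpha>. (\<forall>x. B \<alpha> x = 0) \<longrightarrow> \<alpha> = 0) \<and> (\<forall>x. (\<forall>\<alpha>. B \<alpha> x = 0) \<longrightarrow> x = 0)"

definition is_variational_derivative ::
    "('d::locally_convex_space \<Rightarrow> 'e::locally_convex_space \<Rightarrow> real) \<Rightarrow> ('e \<Rightarrow> real) \<Rightarrow> ('e \<Rightarrow> 'd) \<Rightarrow> bool" where
  "is_variational_derivative B H G \<longleftrightarrow>
     smooth G \<and> (\<forall>K. smooth K \<longrightarrow> (\<forall>u. B (G u) (K u) = gateaux H u (K u)))"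

definition variational_derivative ::
    "('d::locally_convex_space \<Rightarrow> 'e::locally_convex_space \<Rightarrow> real) \<Rightarrow> ('e \<Rightarrow> real) \<Rightarrow> 'e \<Rightarrow> 'd" where
  "variational_derivative B H = (THE G. is_variational_derivative B H G)"

text \<open>
  Existence of the variational derivative does not follow from smoothness, because \<open>'d\<close> need not
  be the full dual of \<open>'e\<close>; it is required of the functions considered.
\<close>

definition smooth_functionals ::
    "('d::locally_convex_space \<Rightarrow> 'e::locally_convex_space \<Rightarrow> real) \<Rightarrow> ('e \<Rightarrow> real) set" where
  "smooth_functionals B = {H. smooth H \<and> (\<exists>G. is_variational_derivative B H G)}"

text \<open>
  In \<open>J'(u)[J(u)\<beta>(u)]\<gamma>(u)\<close> only the operator is differentiated; the covector \<open>\<gamma>(u)\<close> is frozen.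
\<close>

definition jacobi_term ::
    "('d::locally_convex_space \<Rightarrow> 'e::locally_convex_space \<Rightarrow> real) \<Rightarrow> ('e \<Rightarrow> 'd \<Rightarrow> 'e) \<Rightarrow>
     ('e \<Rightarrow> 'd) \<Rightarrow> ('e \<Rightarrow> 'd) \<Rightarrow> ('e \<Rightarrow> 'd) \<Rightarrow> 'e \<Rightarrow> real" where
  "jacobi_term B J \<alpha> \<beta> \<gamma> u = B (\<alpha> u) (gateaux (\<lambda>v. J v (\<gamma> u)) u (J u (\<beta> u)))"

definition hamiltonian_operator ::
    "('d::locally_convex_space \<Rightarrow> 'e::locally_convex_space \<Rightarrow> real) \<Rightarrow> ('e \<Rightarrow> 'd \<Rightarrow> 'e) \<Rightarrow> bool" where
  "hamiltonian_operator B J \<longleftrightarrow>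
     (\<forall>u. linear (J u)) \<and> smooth (\<lambda>(u, \<beta>). J u \<beta>) \<and>
     (\<forall>\<alpha> \<beta>. smooth \<alpha> \<and> smooth \<beta> \<longrightarrow> (\<forall>u. B (\<alpha> u) (J u (\<beta> u)) = - B (\<beta> u) (J u (\<alpha> u)))) \<and>
     (\<forall>\<alpha> \<beta> \<gamma>. smooth \<alpha> \<and> smooth \<beta> \<and> smooth \<gamma> \<longrightarrow>
        (\<forall>u. jacobi_term B J \<alpha> \<beta> \<gamma> u + jacobi_term B J \<beta> \<gamma> \<alpha> u + jacobi_term B J \<gamma> \<alpha> \<beta> u = 0))"

definition poisson_bracket ::
    "('d::locally_convex_space \<Rightarrow> 'e::locally_convex_space \<Rightarrow> real) \<Rightarrow> ('e \<Rightarrow> 'd \<Rightarrow> 'e) \<Rightarrow>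
     ('e \<Rightarrow> real) \<Rightarrow> ('e \<Rightarrow> real) \<Rightarrow> 'e \<Rightarrow> real" where
  "poisson_bracket B J H1 H2 u =
     B (variational_derivative B H1 u) (J u (variational_derivative B H2 u))"

definition hamiltonian_pair ::
    "('d::locally_convex_space \<Rightarrow> 'e::locally_convex_space \<Rightarrow> real) \<Rightarrow>
     ('e \<Rightarrow> 'd \<Rightarrow> 'e) \<Rightarrow> ('e \<Rightarrow> 'd \<Rightarrow> 'e) \<Rightarrow> bool" where
  "hamiltonian_pair B J J' \<longleftrightarrow>
     (\<forall>c::real. hamiltonian_operator B (\<lambda>u \<beta>. J u \<beta> + c *\<^sub>R J' u \<beta>))"

text \<open>The equation \<open>u\<^sub>t = K(u)\<close> is identified with its right-hand side \<open>K\<close>.\<close>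

definition hamiltonian_structure ::
    "('d::locally_convex_space \<Rightarrow> 'e::locally_convex_space \<Rightarrow> real) \<Rightarrow> ('e \<Rightarrow> 'e) \<Rightarrow>
     ('e \<Rightarrow> 'd \<Rightarrow> 'e) \<Rightarrow> ('e \<Rightarrow> real) \<Rightarrow> bool" where
  "hamiltonian_structure B K J H \<longleftrightarrow>
     hamiltonian_operator B J \<and> H \<in> smooth_functionals B \<and>
     (\<forall>u. K u = J u (variational_derivative B H u))"

definition multi_hamiltonian_structure ::
    "('d::locally_convex_space \<Rightarrow> 'e::locally_convex_space \<Rightarrow> real) \<Rightarrow> ('e \<Rightarrow> 'e) \<Rightarrow> nat \<Rightarrow>
     (nat \<Rightarrow> 'e \<Rightarrow> 'd \<Rightarrow> 'e) \<Rightarrow> (nat \<Rightarrow> 'e \<Rightarrow> real) \<Rightarrow> bool" where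
  "multi_hamiltonian_structure B K m J H \<longleftrightarrow>
     (\<forall>k\<in>{1..m}. hamiltonian_structure B K (J k) (H k)) \<and>
     (\<forall>k\<in>{1..m}. \<forall>l\<in>{1..m}. k \<noteq> l \<longrightarrow> hamiltonian_pair B (J k) (J l))"

section \<open>Perturbation equations\<close>

text \<open>
  An \<open>(N + 1)\<close>-tuple \<open>(\<eta>\<^sub>0, \<dots>, \<eta>\<^sub>N)\<close> is a vector \<open>\<eta> :: 'e ^ 'n\<close> together with a numbering
  \<open>idx\<close>, a bijection from the index type \<open>'n\<close> onto \<open>{0..N}\<close>: the component \<open>\<eta>\<^sub>k\<close> is \<open>\<eta> $ i\<close> for
  the \<open>i\<close> with \<open>idx i = k\<close>.
\<close>

definition pert_pairing ::
    "('d::locally_convex_space \<Rightarrow> 'e::locally_convex_space \<Rightarrow> real) \<Rightarrow> 'd ^ 'n \<Rightarrow> 'e ^ 'n \<Rightarrow> real" where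
  "pert_pairing B \<alpha> x = (\<Sum>i\<in>UNIV. B (\<alpha> $ i) (x $ i))"

definition taylor_coeff :: "nat \<Rightarrow> (real \<Rightarrow> 'a::locally_convex_space) \<Rightarrow> 'a" where
  "taylor_coeff k c = (1 / fact k) *\<^sub>R (curve_deriv ^^ k) c 0"

definition pert_curve :: "('n \<Rightarrow> nat) \<Rightarrow> ('e::locally_convex_space) ^ 'n \<Rightarrow> real \<Rightarrow> 'e" where
  "pert_curve idx \<eta> \<epsilon> = (\<Sum>i\<in>UNIV. \<epsilon> ^ idx i *\<^sub>R \<eta> $ i)"

definition pert_field ::
    "('n \<Rightarrow> nat) \<Rightarrow> ('e::locally_convex_space \<Rightarrow> 'e) \<Rightarrow> 'e ^ 'n \<Rightarrow> 'e ^ 'n" where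
  "pert_field idx K \<eta> = (\<chi> i. taylor_coeff (idx i) (\<lambda>\<epsilon>. K (pert_curve idx \<eta> \<epsilon>)))"

definition pert_functional ::
    "nat \<Rightarrow> ('n \<Rightarrow> nat) \<Rightarrow> ('e::locally_convex_space \<Rightarrow> real) \<Rightarrow> 'e ^ 'n \<Rightarrow> real" where
  "pert_functional N idx H \<eta> = taylor_coeff N (\<lambda>\<epsilon>. H (pert_curve idx \<eta> \<epsilon>))"

text \<open>The derivatives of the operator-valued map \<open>\<epsilon> \<mapsto> J(\<Sum>\<^sub>i \<epsilon>\<^sup>i \<eta>\<^sub>i)\<close> are taken pointwise on covectors.\<close>

definition pert_block ::
    "nat \<Rightarrow> ('n \<Rightarrow> nat) \<Rightarrow> ('e::locally_convex_space \<Rightarrow> 'd::locally_convex_space \<Rightarrow> 'e) \<Rightarrow>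
     'e ^ 'n \<Rightarrow> nat \<Rightarrow> nat \<Rightarrow> 'd \<Rightarrow> 'e" where
  "pert_block N idx J \<eta> i j \<beta> =
     (if i + j < N then 0 else taylor_coeff (i + j - N) (\<lambda>\<epsilon>. J (pert_curve idx \<eta> \<epsilon>) \<beta>))"

definition pert_operator ::
    "nat \<Rightarrow> ('n \<Rightarrow> nat) \<Rightarrow> ('e::locally_convex_space \<Rightarrow> 'd::locally_convex_space \<Rightarrow> 'e) \<Rightarrow>
     'e ^ 'n \<Rightarrow> 'd ^ 'n \<Rightarrow> 'e ^ 'n" where
  "pert_operator N idx J \<eta> \<beta> =
     (\<chi> i. \<Sum>j\<in>UNIV. pert_block N idx J \<eta> (idx i) (idx j) (\<beta> $ j))"

end

theory Submission
  imports Defs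
begin

text \<open>
  Write \<open>u(\<epsilon>) = \<Sum>\<^sub>i \<epsilon>\<^sup>i \<eta>\<^sub>i\<close>.  Numbering covectors downwards, \<open>\<beta>(\<epsilon>) = \<Sum>\<^sub>i \<epsilon>\<^sup>N\<^sup>-\<^sup>i \<beta>\<^sub>i\<close>, the pairing of
  \<open>\<alpha>\<close> with \<open>x\<close> is the \<open>N\<close>-th Taylor coefficient of \<open>\<langle>\<alpha>(\<epsilon>), x(\<epsilon>)\<rangle>\<close>, the perturbed operator sends
  \<open>\<beta>\<close> to the first \<open>N + 1\<close> Taylor coefficients of \<open>J(u(\<epsilon>))\<beta>(\<epsilon>)\<close>, and \<open>G(u(\<epsilon>))\<close> represents the
  variational derivative of the perturbed functional when \<open>G\<close> is that of the functional.  All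
  these identities are insensitive to changes of order \<open>\<epsilon>\<^sup>N\<^sup>+\<^sup>1\<close>, so skew-symmetry, the
  Jacobi identity, the equation and the bracket formula are the \<open>N\<close>-th Taylor coefficients of the
  corresponding identities for \<open>J\<close> along \<open>u(\<epsilon>)\<close>.

  The analytic input is the interchange of \<open>\<partial>/\<partial>s\<close> with Taylor coefficients in \<open>\<epsilon>\<close> (symmetry of mixed
  derivatives), additivity of Gateaux derivatives in the direction, and Hadamard's lemma: a smooth
  curve has Taylor expansions with a smooth remainder.  The last point replaces the Leibniz and chain
  rules, because smooth linear maps need not be continuous here.
\<close>

section \<open>Curves in locally convex spaces\<close>

lemma tendsto_scaleR_lcs:
  fixes g :: "'b \<Rightarrow> 'a::locally_convex_space"
  assumes "(f \<longlongrightarrow> r) F" "(g \<longlongrightarrow> x) F"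
  shows "((\<lambda>z. f z *\<^sub>R g z) \<longlongrightarrow> r *\<^sub>R x) F"
  using filterlim_compose[OF tendsto_scaleR_nhds filterlim_Pair[OF assms]] by simp

lemma continuous_on_scaleR_lcs:
  fixes g :: "'b::topological_space \<Rightarrow> 'a::locally_convex_space"
  assumes "continuous_on S f" "continuous_on S g"
  shows "continuous_on S (\<lambda>z. f z *\<^sub>R g z)"
  using assms unfolding continuous_on_def by (blast intro: tendsto_scaleR_lcs)

text \<open>The increment of \<open>c\<close> is \<open>h\<close> times the difference quotient, and
  scalar multiplication is jointly continuous.\<close>

lemma has_curve_deriv_tendsto:
  assumes "has_curve_deriv c d t"
  shows "((\<lambda>h. c (t + h)) \<longlongrightarrow> c t) (at 0)"
proof -
  have "((\<lambda>h. c t + h *\<^sub>R ((1 / h) *\<^sub>R (c (t + h) - c t))) \<longlongrightarrow> c t + 0 *\<^sub>R d) (at 0)"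
    using assms unfolding has_curve_deriv_def
    by (intro tendsto_add tendsto_const tendsto_scaleR_lcs tendsto_ident_at)
  moreover have "\<forall>\<^sub>F h in at 0. c t + h *\<^sub>R ((1 / h) *\<^sub>R (c (t + h) - c t)) = c (t + h)"
    unfolding eventually_at_filter by (intro always_eventually) auto
  ultimately show ?thesis
    by (simp add: tendsto_cong)
qed

lemma has_curve_deriv_isCont:
  assumes "has_curve_deriv c d t"
  shows "isCont c t"
  using has_curve_deriv_tendsto[OF assms] by (simp add: isCont_iff)

lemma curve_deriv_eqI: "(\<And>t. has_curve_deriv c (d t) t) \<Longrightarrow> curve_deriv c = d"
  by (rule ext) (rule has_curve_deriv_imp_curve_deriv)

lemma has_curve_deriv_const: "has_curve_deriv (\<lambda>_. a) 0 t"
  unfolding has_curve_deriv_def by simp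

lemma has_curve_deriv_ident: "has_curve_deriv (\<lambda>s. s) (1::real) t"
  unfolding has_curve_deriv_iff_has_vector_derivative by (auto intro!: derivative_eq_intros)

lemma has_curve_deriv_add:
  assumes "has_curve_deriv c d t" "has_curve_deriv c' d' t"
  shows "has_curve_deriv (\<lambda>s. c s + c' s) (d + d') t"
  using tendsto_add[OF assms[unfolded has_curve_deriv_def]]
  unfolding has_curve_deriv_def by (simp add: scaleR_right_diff_distrib scaleR_right_distrib algebra_simps)

text \<open>The difference quotient of the product splits into two terms, each a product of
  convergent factors; joint continuity of scalar multiplication then gives the limit.\<close>

lemma has_curve_deriv_scaleR:
  assumes "has_curve_deriv a a' t" "has_curve_deriv c d t"
  shows "has_curve_deriv (\<lambda>s. a s *\<^sub>R c s) (a t *\<^sub>R d + a' *\<^sub>R c t) t"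
proof -
  have "((\<lambda>h. a (t + h) *\<^sub>R ((1 / h) *\<^sub>R (c (t + h) - c t)) + ((1 / h) *\<^sub>R (a (t + h) - a t)) *\<^sub>R c t)
      \<longlongrightarrow> a t *\<^sub>R d + a' *\<^sub>R c t) (at 0)"
    using assms has_curve_deriv_tendsto[OF assms(1)] unfolding has_curve_deriv_def
    by (intro tendsto_add tendsto_const tendsto_scaleR_lcs)
  then show ?thesis
    unfolding has_curve_deriv_def
    by (rule filterlim_cong[THEN iffD1, OF refl refl, rotated])
      (auto simp: scaleR_right_diff_distrib scaleR_left_diff_distrib diff_divide_distrib mult.commute)
qed

lemma has_curve_deriv_scaleR_const:
  "has_curve_deriv c d t \<Longrightarrow> has_curve_deriv (\<lambda>s. r *\<^sub>R c s) (r *\<^sub>R d) t"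
  using has_curve_deriv_scaleR[OF has_curve_deriv_const] by fastforce

lemma has_curve_deriv_diff:
  assumes "has_curve_deriv c d t" "has_curve_deriv c' d' t"
  shows "has_curve_deriv (\<lambda>s. c s - c' s) (d - d') t"
  using has_curve_deriv_add[OF assms(1) has_curve_deriv_scaleR_const[OF assms(2), of "-1"]] by simp

lemma has_curve_deriv_power: "has_curve_deriv (\<lambda>s. s ^ n) (real n * t ^ (n - 1)) t"
  unfolding has_curve_deriv_iff_has_vector_derivative has_real_derivative_iff_has_vector_derivative[symmetric]
  by (auto intro!: derivative_eq_intros)

lemma has_curve_deriv_Pair:
  assumes "has_curve_deriv c d t" "has_curve_deriv c' d' t"
  shows "has_curve_deriv (\<lambda>s. (c s, c' s)) (d, d') t"
  using tendsto_Pair[OF assms[unfolded has_curve_deriv_def]] unfolding has_curve_deriv_def by simp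

lemma has_curve_deriv_fst: "has_curve_deriv c d t \<Longrightarrow> has_curve_deriv (\<lambda>s. fst (c s)) (fst d) t"
  unfolding has_curve_deriv_def by (drule tendsto_fst) simp

lemma has_curve_deriv_snd: "has_curve_deriv c d t \<Longrightarrow> has_curve_deriv (\<lambda>s. snd (c s)) (snd d) t"
  unfolding has_curve_deriv_def by (drule tendsto_snd) simp

lemma has_curve_deriv_vec_nth: "has_curve_deriv c d t \<Longrightarrow> has_curve_deriv (\<lambda>s. c s $ i) (d $ i) t"
  unfolding has_curve_deriv_def by (drule tendsto_vec_nth[where i = i]) simp

lemma has_curve_deriv_vec:
  assumes "\<And>i. has_curve_deriv (\<lambda>s. c s $ i) (d $ i) t"
  shows "has_curve_deriv c d t"
  using assms unfolding has_curve_deriv_def by (intro vec_tendstoI) simp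

text \<open>Substituting \<open>h * r\<close> for \<open>h\<close> in the limit works for nonzero
  \<open>r\<close>; for \<open>r = 0\<close> the curve is constant. This yields homogeneity of
  Gateaux derivatives.\<close>

lemma has_curve_deriv_rescale:
  assumes "has_curve_deriv c d 0"
  shows "has_curve_deriv (\<lambda>s. c (s * r)) (r *\<^sub>R d) 0"
proof (cases "r = 0")
  case True
  then show ?thesis by (simp add: has_curve_deriv_const)
next
  case False
  then have "filterlim (\<lambda>h. h * r) (at 0) (at 0)"
    by (auto simp: filterlim_at eventually_at_filter intro!: tendsto_eq_intros)
  from filterlim_compose[OF assms[unfolded has_curve_deriv_def] this]
  have "((\<lambda>h. r *\<^sub>R ((1 / (h * r)) *\<^sub>R (c (0 + h * r) - c 0))) \<longlongrightarrow> r *\<^sub>R d) (at 0)"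
    by (intro tendsto_scaleR_lcs tendsto_const)
  then show ?thesis
    using False unfolding has_curve_deriv_def by simp
qed

text \<open>Membership of difference quotients in a convex set passes from adjacent intervals to their union.\<close>

lemma curve_mean_value_less:
  assumes "a < b" and V: "open V" "convex V"
    and c: "\<And>t. a \<le> t \<Longrightarrow> t \<le> b \<Longrightarrow> \<exists>d\<in>V. has_curve_deriv c d t"
  shows "(1 / (b - a)) *\<^sub>R (c b - c a) \<in> V"
proof -
  \<comment> \<open>The guard \<open>x < y\<close> makes degenerate intervals harmless, as they
    occur when a point of subdivision is an endpoint.\<close>
  define P where "P x y \<longleftrightarrow> (x < y \<longrightarrow> (1 / (y - x)) *\<^sub>R (c y - c x) \<in> V)" for x y
  have trans: "P x z" if "P x y" "P y z" "x \<le> y" "y \<le> z" for x y z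
  proof (cases "x < y \<and> y < z")
    case True
    \<comment> \<open>The quotient over the union is the convex combination of the two quotients,
      weighted by the relative lengths of the intervals.\<close>
    then have "((y - x) / (z - x)) *\<^sub>R ((1 / (y - x)) *\<^sub>R (c y - c x)) +
        ((z - y) / (z - x)) *\<^sub>R ((1 / (z - y)) *\<^sub>R (c z - c y)) \<in> V"
      using that unfolding P_def
      by (intro convexD[OF V(2)]) (auto simp: add_divide_distrib[symmetric])
    moreover have "((y - x) / (z - x)) *\<^sub>R ((1 / (y - x)) *\<^sub>R (c y - c x)) +
        ((z - y) / (z - x)) *\<^sub>R ((1 / (z - y)) *\<^sub>R (c z - c y)) = (1 / (z - x)) *\<^sub>R (c z - c x)"
      using True by (simp add: scaleR_right_distrib[symmetric])
    ultimately show ?thesis by (simp add: P_def)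
  next
    case False
    then show ?thesis using that by (cases "x = y") auto
  qed
  have "P a b"
  \<comment> \<open>Bisection: \<open>P\<close> passes to unions of adjacent intervals, so it only
    has to be shown for small intervals around each point.\<close>
  proof (rule Bolzano)
    show "a \<le> b" using assms by simp
    show "P x z" if "P x y" "P y z" "x \<le> y" "y \<le> z" for x y z
      using trans[OF that] .
    fix x assume x: "a \<le> x" "x \<le> b"
    obtain d where "d \<in> V" "has_curve_deriv c d x" using c[OF x] by blast
    then have "\<forall>\<^sub>F h in at 0. (1 / h) *\<^sub>R (c (x + h) - c x) \<in> V"
      unfolding has_curve_deriv_def using V topological_tendstoD by blast
    then obtain e where e: "e > 0" "\<And>h. h \<noteq> 0 \<Longrightarrow> \<bar>h\<bar> < e \<Longrightarrow> (1 / h) *\<^sub>R (c (x + h) - c x) \<in> V"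
      unfolding eventually_at by (auto simp: dist_real_def)
    show "\<exists>e>0. \<forall>y z. y \<le> x \<and> x \<le> z \<and> z - y < e \<longrightarrow> P y z"
    proof (intro exI conjI allI impI)
      show "e > 0" by fact
      fix y z assume yz: "y \<le> x \<and> x \<le> z \<and> z - y < e"
      have "P x z" using e(2)[of "z - x"] yz by (auto simp: P_def)
      moreover have "P y x"
      \<comment> \<open>The difference quotient is symmetric in its two endpoints, so the limit at
        \<open>x\<close> also controls intervals to the left of \<open>x\<close>.\<close>
      proof (cases "y < x")
        case True
        have "(1 / (y - x)) *\<^sub>R (c (x + (y - x)) - c x) = (1 / (x - y)) *\<^sub>R (c x - c y)"
          by (metis (no_types, opaque_lifting) add_diff_cancel_left' diff_add_cancel add.commute
              divide_minus_right minus_diff_eq scaleR_minus_left scaleR_minus_right)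
        then show ?thesis using e(2)[of "y - x"] yz True by (auto simp: P_def)
      qed (simp add: P_def)
      ultimately show "P y z" using trans yz by blast
    qed
  qed
  then show ?thesis using assms by (simp add: P_def)
qed

lemma curve_mean_value:
  assumes "a \<noteq> b" "open V" "convex V"
    and c: "\<And>t. t \<in> closed_segment a b \<Longrightarrow> \<exists>d\<in>V. has_curve_deriv c d t"
  shows "(1 / (b - a)) *\<^sub>R (c b - c a) \<in> V"
proof (cases "a < b")
  case True
  then show ?thesis
    using assms by (intro curve_mean_value_less) (auto simp: closed_segment_eq_real_ivl)
next
  case False
  then have "(1 / (a - b)) *\<^sub>R (c a - c b) \<in> V"
    using assms by (intro curve_mean_value_less) (auto simp: closed_segment_eq_real_ivl)
  moreover have "(1 / (a - b)) *\<^sub>R (c a - c b) = (1 / (b - a)) *\<^sub>R (c b - c a)"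
    by (metis (no_types, opaque_lifting) divide_minus_right minus_diff_eq scaleR_minus_left scaleR_minus_right)
  ultimately show ?thesis by simp
qed

section \<open>Smooth plots\<close>

lemma smooth_plot_cong:
  assumes "smooth_plot n p" "\<And>i. i < n \<Longrightarrow> s i = t i"
  shows "p s = p t"
  using assms unfolding smooth_plot_def by blast

lemma smooth_plot_continuous: "smooth_plot n p \<Longrightarrow> continuous_on UNIV p"
  unfolding smooth_plot_def by (metis empty_set empty_subsetI foldr.simps(1) id_apply)

lemma smooth_plot_has_deriv:
  assumes "smooth_plot n p" "i < n"
  shows "has_curve_deriv (\<lambda>s. p (t(i := s))) (partial_deriv i p (t(i := x))) x"
proof -
  have "\<exists>d. has_curve_deriv (\<lambda>s. foldr partial_deriv [] p ((t(i := x))(i := s))) d ((t(i := x)) i)"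
    using assms unfolding smooth_plot_def by (metis empty_set empty_subsetI)
  then obtain d where d: "has_curve_deriv (\<lambda>s. p (t(i := s))) d x"
    by auto
  then show ?thesis
    by (simp add: partial_deriv_def has_curve_deriv_imp_curve_deriv[OF d])
qed

lemma partial_deriv_eqI:
  assumes "\<And>t. has_curve_deriv (\<lambda>s. p (t(i := s))) (q t) (t i)"
  shows "partial_deriv i p = q"
  by (rule ext) (simp add: partial_deriv_def has_curve_deriv_imp_curve_deriv[OF assms])

text \<open>\<open>foldr\<close> applies the last index first, so appending \<open>i\<close> to a
  list turns iterated derivatives of \<open>partial_deriv i p\<close> into iterated derivatives of
  \<open>p\<close>.\<close>

lemma smooth_plot_partial_deriv:
  assumes "smooth_plot n p" "i < n"
  shows "smooth_plot n (partial_deriv i p)"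
proof -
  have dep: "partial_deriv i p s = partial_deriv i p t" if "\<forall>i<n. s i = t i" for s t
  proof -
    have "p (s(i := x)) = p (t(i := x))" for x
      using that by (intro smooth_plot_cong[OF assms(1)]) auto
    then show ?thesis using that assms(2) by (simp add: partial_deriv_def)
  qed
  show ?thesis
    unfolding smooth_plot_def
  proof (intro conjI allI impI)
    fix "is" assume "set is \<subseteq> {..<n}"
    then have "set (is @ [i]) \<subseteq> {..<n}" using assms(2) by simp
    then have "continuous_on UNIV (foldr partial_deriv (is @ [i]) p) \<and>
        (\<forall>j<n. \<forall>t. \<exists>d. has_curve_deriv (\<lambda>s. foldr partial_deriv (is @ [i]) p (t(j := s))) d (t j))"
      using assms(1) unfolding smooth_plot_def by blast
    then show "continuous_on UNIV (foldr partial_deriv is (partial_deriv i p))"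
      "\<And>j t. j < n \<Longrightarrow>
        \<exists>d. has_curve_deriv (\<lambda>s. foldr partial_deriv is (partial_deriv i p) (t(j := s))) d (t j)"
      by simp_all
  qed (use dep in blast)
qed

text \<open>This acts as a coinduction principle: a class \<open>Q\<close> of continuous functions
  that is closed under first partial derivatives contains every iterated derivative of its members,
  so these need not be computed.\<close>

lemma smooth_plotI:
  assumes Q: "Q p"
    and dep: "\<And>s t. (\<And>i. i < n \<Longrightarrow> s i = t i) \<Longrightarrow> p s = p t"
    and cont: "\<And>f. Q f \<Longrightarrow> continuous_on UNIV f"
    and deriv: "\<And>f i. Q f \<Longrightarrow> i < n \<Longrightarrow>
      \<exists>g. Q g \<and> (\<forall>t. has_curve_deriv (\<lambda>s. f (t(i := s))) (g t) (t i))"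
  shows "smooth_plot n p"
proof -
  have step: "Q (partial_deriv i f)" if "Q f" "i < n" for f i
    using deriv[OF that] partial_deriv_eqI by metis
  have "Q (foldr partial_deriv is p)" if "set is \<subseteq> {..<n}" for "is"
    using that by (induction "is") (simp_all add: Q step)
  then show ?thesis
    unfolding smooth_plot_def using dep cont deriv by blast
qed

section \<open>Closure properties of smooth plots\<close>

lemma smooth_plot_const: "smooth_plot n (\<lambda>_. a)"
  by (rule smooth_plotI[where Q = "\<lambda>f. \<exists>a. f = (\<lambda>_. a)"]) (auto intro: has_curve_deriv_const)

lemma smooth_plot_coord:
  assumes "i < n"
  shows "smooth_plot n (\<lambda>t. t i)"
\<comment> \<open>Constants belong to the class because the partial derivatives of a coordinate are
  the constants 0 and 1.\<close>
proof (rule smooth_plotI[where Q = "\<lambda>f. f = (\<lambda>t. t i) \<or> (\<exists>a. f = (\<lambda>_. a))"])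
  fix f :: "(nat \<Rightarrow> real) \<Rightarrow> real" and j
  assume f: "f = (\<lambda>t. t i) \<or> (\<exists>a. f = (\<lambda>_. a))"
  then show "continuous_on UNIV f"
    by (elim disjE exE) (simp_all add: continuous_on_product_coordinates)
  have "has_curve_deriv (\<lambda>s. (t(j := s)) i) (if i = j then 1 else 0) (t j)" for t :: "nat \<Rightarrow> real"
    by (auto intro: has_curve_deriv_ident has_curve_deriv_const)
  with f have "\<exists>d. \<forall>t. has_curve_deriv (\<lambda>s. f (t(j := s))) d (t j)"
    using has_curve_deriv_const by (elim disjE exE) (simp only:, blast)+
  then show "\<exists>g. (g = (\<lambda>t. t i) \<or> (\<exists>a. g = (\<lambda>_. a))) \<and>
      (\<forall>t. has_curve_deriv (\<lambda>s. f (t(j := s))) (g t) (t j))"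
    by blast
qed (use assms in auto)

lemma smooth_plot_weaken:
  assumes "smooth_plot n p" "n \<le> m"
  shows "smooth_plot m p"
proof (rule smooth_plotI[where Q = "smooth_plot n"])
  fix f :: "_ \<Rightarrow> 'a" and i assume f: "smooth_plot n f"
  show "\<exists>g. smooth_plot n g \<and> (\<forall>t. has_curve_deriv (\<lambda>s. f (t(i := s))) (g t) (t i))"
  proof (cases "i < n")
    case True
    then show ?thesis
      using smooth_plot_partial_deriv[OF f True] smooth_plot_has_deriv[OF f True] by (metis fun_upd_triv)
  next
    case False
    then have "f (t(i := s)) = f t" for t s
      by (intro smooth_plot_cong[OF f]) auto
    then show ?thesis
      by (intro exI[of _ "\<lambda>_. 0"]) (simp add: has_curve_deriv_const smooth_plot_const)
  qed
next
  fix s t :: "nat \<Rightarrow> real" assume "\<And>i. i < m \<Longrightarrow> s i = t i"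
  then show "p s = p t"
    using assms(2) by (intro smooth_plot_cong[OF assms(1)]) simp
qed (simp_all add: assms smooth_plot_continuous)

text \<open>This sets an adjoined last parameter to a fixed value after differentiation in it, as
  Taylor coefficients and Gateaux derivatives require.\<close>

lemma smooth_plot_restrict:
  assumes "smooth_plot (Suc n) p"
  shows "smooth_plot n (\<lambda>t. p (t(n := r)))"
proof (rule smooth_plotI[where Q = "\<lambda>f. \<exists>p. smooth_plot (Suc n) p \<and> f = (\<lambda>t. p (t(n := r)))"])
  fix f :: "_ \<Rightarrow> 'a" and i
  assume "\<exists>p. smooth_plot (Suc n) p \<and> f = (\<lambda>t. p (t(n := r)))"
  then obtain p where p: "smooth_plot (Suc n) p" and f: "f = (\<lambda>t. p (t(n := r)))" by blast
  have "continuous_on UNIV (\<lambda>t::nat \<Rightarrow> real. t(n := r))"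
    by (rule continuous_on_coordinatewise_then_product)
      (case_tac "i = n"; simp add: continuous_on_product_coordinates)
  then show "continuous_on UNIV f"
    unfolding f using continuous_on_compose2[OF smooth_plot_continuous[OF p]] by blast
  assume "i < n"
  then have "i < Suc n" "i \<noteq> n" by auto
  then have "has_curve_deriv (\<lambda>s. f (t(i := s))) (partial_deriv i p (t(n := r))) (t i)" for t
    using smooth_plot_has_deriv[OF p, of i "t(n := r)" "t i"] unfolding f
    by (metis (no_types, lifting) ext fun_upd_triv fun_upd_twist)
  then show "\<exists>g. (\<exists>p. smooth_plot (Suc n) p \<and> g = (\<lambda>t. p (t(n := r)))) \<and>
      (\<forall>t. has_curve_deriv (\<lambda>s. f (t(i := s))) (g t) (t i))"
    using smooth_plot_partial_deriv[OF p \<open>i < Suc n\<close>] by blast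
next
  fix s t :: "nat \<Rightarrow> real" assume st: "\<And>i. i < n \<Longrightarrow> s i = t i"
  show "p (s(n := r)) = p (t(n := r))"
    by (rule smooth_plot_cong[OF assms]) (auto simp: st less_Suc_eq)
qed (rule exI, rule conjI, rule assms, rule refl)

lemma smooth_plot_add:
  assumes "smooth_plot n p" "smooth_plot n q"
  shows "smooth_plot n (\<lambda>t. p t + q t)"
proof (rule smooth_plotI[where Q = "\<lambda>f. \<exists>p q. smooth_plot n p \<and> smooth_plot n q \<and> f = (\<lambda>t. p t + q t)"])
  fix f :: "_ \<Rightarrow> 'a" and i
  assume "\<exists>p q. smooth_plot n p \<and> smooth_plot n q \<and> f = (\<lambda>t. p t + q t)"
  then obtain p q where p: "smooth_plot n p" and q: "smooth_plot n q" and f: "f = (\<lambda>t. p t + q t)"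
    by blast
  show "continuous_on UNIV f"
    unfolding f by (intro continuous_on_add smooth_plot_continuous[OF p] smooth_plot_continuous[OF q])
  assume i: "i < n"
  have "has_curve_deriv (\<lambda>s. f (t(i := s))) (partial_deriv i p t + partial_deriv i q t) (t i)" for t
    unfolding f
    using has_curve_deriv_add[OF smooth_plot_has_deriv[OF p i, of t "t i"] smooth_plot_has_deriv[OF q i, of t "t i"]]
    by simp
  then show "\<exists>g. (\<exists>p q. smooth_plot n p \<and> smooth_plot n q \<and> g = (\<lambda>t. p t + q t)) \<and>
      (\<forall>t. has_curve_deriv (\<lambda>s. f (t(i := s))) (g t) (t i))"
    using smooth_plot_partial_deriv[OF p i] smooth_plot_partial_deriv[OF q i] by blast
next
  fix s t :: "nat \<Rightarrow> real" assume st: "\<And>i. i < n \<Longrightarrow> s i = t i"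
  show "p s + q s = p t + q t"
    using smooth_plot_cong[OF assms(1) st] smooth_plot_cong[OF assms(2) st] by simp
qed (rule exI, rule exI, rule conjI, rule assms(1), rule conjI, rule assms(2), rule refl)

lemma smooth_plot_sum:
  "(\<And>i. i \<in> I \<Longrightarrow> smooth_plot n (p i)) \<Longrightarrow> smooth_plot n (\<lambda>t. \<Sum>i\<in>I. p i t)"
  by (induction I rule: infinite_finite_induct) (simp_all add: smooth_plot_const smooth_plot_add)

text \<open>By the Leibniz rule a derivative of a product is a sum of two products. Products alone
  are therefore not closed under differentiation, but their finite sums are.\<close>

inductive plot_product_sum :: "nat \<Rightarrow> ((nat \<Rightarrow> real) \<Rightarrow> 'a::locally_convex_space) \<Rightarrow> bool" for n where
  scaleR: "smooth_plot n a \<Longrightarrow> smooth_plot n p \<Longrightarrow> plot_product_sum n (\<lambda>t. a t *\<^sub>R p t)"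
| add: "plot_product_sum n f \<Longrightarrow> plot_product_sum n g \<Longrightarrow> plot_product_sum n (\<lambda>t. f t + g t)"

lemma smooth_plot_scaleR:
  assumes "smooth_plot n a" "smooth_plot n p"
  shows "smooth_plot n (\<lambda>t. a t *\<^sub>R p t)"
proof (rule smooth_plotI[where Q = "plot_product_sum n"])
  fix f :: "_ \<Rightarrow> 'a" and i
  assume f: "plot_product_sum n f"
  then show "continuous_on UNIV f"
    by induction (auto intro: continuous_on_add continuous_on_scaleR_lcs smooth_plot_continuous)
  assume i: "i < n"
  from f show "\<exists>g. plot_product_sum n g \<and> (\<forall>t. has_curve_deriv (\<lambda>s. f (t(i := s))) (g t) (t i))"
  proof induction
    case (scaleR a p)
    have "has_curve_deriv (\<lambda>s. a (t(i := s)) *\<^sub>R p (t(i := s)))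
        (a t *\<^sub>R partial_deriv i p t + partial_deriv i a t *\<^sub>R p t) (t i)" for t
      using has_curve_deriv_scaleR[OF smooth_plot_has_deriv[OF scaleR(1) i, of t "t i"]
          smooth_plot_has_deriv[OF scaleR(2) i, of t "t i"]]
      by simp
    moreover have "plot_product_sum n (\<lambda>t. a t *\<^sub>R partial_deriv i p t + partial_deriv i a t *\<^sub>R p t)"
      by (intro plot_product_sum.intros scaleR smooth_plot_partial_deriv i)
    ultimately show ?case by blast
  next
    case (add f g)
    then obtain f' g' where "plot_product_sum n f'" "plot_product_sum n g'"
      "\<forall>t. has_curve_deriv (\<lambda>s. f (t(i := s))) (f' t) (t i)"
      "\<forall>t. has_curve_deriv (\<lambda>s. g (t(i := s))) (g' t) (t i)"
      by blast
    then show ?case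
      by (intro exI[of _ "\<lambda>t. f' t + g' t"] conjI allI has_curve_deriv_add plot_product_sum.add) blast+
  qed
next
  fix s t :: "nat \<Rightarrow> real" assume st: "\<And>i. i < n \<Longrightarrow> s i = t i"
  show "a s *\<^sub>R p s = a t *\<^sub>R p t"
    using smooth_plot_cong[OF assms(1) st] smooth_plot_cong[OF assms(2) st] by simp
qed (rule plot_product_sum.scaleR[OF assms])

lemma smooth_plot_power:
  fixes e :: "_ \<Rightarrow> real"
  assumes "smooth_plot n e"
  shows "smooth_plot n (\<lambda>t. e t ^ k)"
proof (induction k)
  case (Suc k)
  then show ?case using smooth_plot_scaleR[OF assms Suc] by simp
qed (simp add: smooth_plot_const)

lemma smooth_plot_vec:
  fixes p :: "_ \<Rightarrow> 'a::locally_convex_space ^ 'n"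
  assumes p: "\<And>i. smooth_plot n (\<lambda>t. p t $ i)"
  shows "smooth_plot n p"
proof (rule smooth_plotI[where Q = "\<lambda>f. \<forall>i. smooth_plot n (\<lambda>t. f t $ i)"])
  fix f :: "_ \<Rightarrow> 'a ^ 'n" and j
  assume f: "\<forall>i. smooth_plot n (\<lambda>t. f t $ i)"
  have "continuous_on UNIV (\<lambda>t. f t $ i)" for i
    using f by (intro smooth_plot_continuous) blast
  then show "continuous_on UNIV f"
    unfolding continuous_on_def by (blast intro: vec_tendstoI)
  assume j: "j < n"
  define g where "g t = (\<chi> i. partial_deriv j (\<lambda>t. f t $ i) t)" for t
  have "has_curve_deriv (\<lambda>s. f (t(j := s))) (g t) (t j)" for t
  proof (rule has_curve_deriv_vec)
    fix i
    show "has_curve_deriv (\<lambda>s. f (t(j := s)) $ i) (g t $ i) (t j)"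
      using smooth_plot_has_deriv[OF f[rule_format, of i] j, of t "t j"] by (simp add: g_def)
  qed
  moreover have "\<forall>i. smooth_plot n (\<lambda>t. g t $ i)"
    using f by (simp add: g_def smooth_plot_partial_deriv[OF _ j])
  ultimately show "\<exists>g. (\<forall>i. smooth_plot n (\<lambda>t. g t $ i)) \<and>
      (\<forall>t. has_curve_deriv (\<lambda>s. f (t(j := s))) (g t) (t j))" by blast
next
  fix s t :: "nat \<Rightarrow> real" assume st: "\<And>i. i < n \<Longrightarrow> s i = t i"
  show "p s = p t"
    using smooth_plot_cong[OF p st] by (simp add: vec_eq_iff)
qed (use p in blast)

lemma smooth_plot_Pair:
  assumes "smooth_plot n p" "smooth_plot n q"
  shows "smooth_plot n (\<lambda>t. (p t, q t))"
proof (rule smooth_plotI[where Q = "\<lambda>f. \<exists>p q. smooth_plot n p \<and> smooth_plot n q \<and> f = (\<lambda>t. (p t, q t))"])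
  fix f :: "_ \<Rightarrow> 'a \<times> 'b" and i
  assume "\<exists>p q. smooth_plot n p \<and> smooth_plot n q \<and> f = (\<lambda>t. (p t, q t))"
  then obtain p q where p: "smooth_plot n p" and q: "smooth_plot n q" and f: "f = (\<lambda>t. (p t, q t))"
    by blast
  show "continuous_on UNIV f"
    unfolding f by (intro continuous_on_Pair smooth_plot_continuous[OF p] smooth_plot_continuous[OF q])
  assume i: "i < n"
  have "has_curve_deriv (\<lambda>s. f (t(i := s))) (partial_deriv i p t, partial_deriv i q t) (t i)" for t
    unfolding f
    using has_curve_deriv_Pair[OF smooth_plot_has_deriv[OF p i, of t "t i"] smooth_plot_has_deriv[OF q i, of t "t i"]]
    by simp
  then show "\<exists>g. (\<exists>p q. smooth_plot n p \<and> smooth_plot n q \<and> g = (\<lambda>t. (p t, q t))) \<and>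
      (\<forall>t. has_curve_deriv (\<lambda>s. f (t(i := s))) (g t) (t i))"
    using smooth_plot_partial_deriv[OF p i] smooth_plot_partial_deriv[OF q i] by blast
next
  fix s t :: "nat \<Rightarrow> real" assume st: "\<And>i. i < n \<Longrightarrow> s i = t i"
  show "(p s, q s) = (p t, q t)"
    using smooth_plot_cong[OF assms(1) st] smooth_plot_cong[OF assms(2) st] by simp
qed (rule exI, rule exI, rule conjI, rule assms(1), rule conjI, rule assms(2), rule refl)

text \<open>A derivative of \<open>L\<close> after \<open>p\<close> is \<open>L\<close> after a
  derivative of \<open>p\<close>, so the form is preserved. The instances of \<open>L\<close> are
  the projections of pairs and vectors.\<close>

lemma smooth_plot_image:
  assumes p: "smooth_plot n p"
    and cont: "continuous_on UNIV L"
    and deriv: "\<And>c d t. has_curve_deriv c d t \<Longrightarrow> has_curve_deriv (\<lambda>s. L (c s)) (L d) t"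
  shows "smooth_plot n (\<lambda>t. L (p t))"
proof (rule smooth_plotI[where Q = "\<lambda>f. \<exists>p. smooth_plot n p \<and> f = (\<lambda>t. L (p t))"])
  fix f and i
  assume "\<exists>p. smooth_plot n p \<and> f = (\<lambda>t. L (p t))"
  then obtain p where p: "smooth_plot n p" and f: "f = (\<lambda>t. L (p t))" by blast
  show "continuous_on UNIV f"
    unfolding f using continuous_on_compose2[OF cont smooth_plot_continuous[OF p]] by blast
  assume i: "i < n"
  have "has_curve_deriv (\<lambda>s. f (t(i := s))) (L (partial_deriv i p t)) (t i)" for t
    unfolding f using deriv[OF smooth_plot_has_deriv[OF p i, of t "t i"]] by simp
  then show "\<exists>g. (\<exists>p. smooth_plot n p \<and> g = (\<lambda>t. L (p t))) \<and>
      (\<forall>t. has_curve_deriv (\<lambda>s. f (t(i := s))) (g t) (t i))"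
    using smooth_plot_partial_deriv[OF p i] by blast
next
  fix s t :: "nat \<Rightarrow> real" assume st: "\<And>i. i < n \<Longrightarrow> s i = t i"
  show "L (p s) = L (p t)"
    using smooth_plot_cong[OF p st] by simp
qed (rule exI, rule conjI, rule p, rule refl)

lemma smooth_plot_vec_nth: "smooth_plot n p \<Longrightarrow> smooth_plot n (\<lambda>t. p t $ i)"
  by (rule smooth_plot_image) (auto intro: has_curve_deriv_vec_nth continuous_on_component continuous_on_id)

lemma smooth_plot_fst: "smooth_plot n p \<Longrightarrow> smooth_plot n (\<lambda>t. fst (p t))"
  by (rule smooth_plot_image) (auto intro: has_curve_deriv_fst continuous_on_fst continuous_on_id)

lemma smooth_plot_snd: "smooth_plot n p \<Longrightarrow> smooth_plot n (\<lambda>t. snd (p t))"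
  by (rule smooth_plot_image) (auto intro: has_curve_deriv_snd continuous_on_snd continuous_on_id)

lemma smooth_const: "smooth (\<lambda>_. a)"
  by (simp add: smooth_def comp_def smooth_plot_const)

lemma smoothD: "smooth X \<Longrightarrow> smooth_plot n p \<Longrightarrow> smooth_plot n (\<lambda>t. X (p t))"
  by (simp add: smooth_def comp_def)

lemma smoothD2:
  assumes "smooth (\<lambda>(x, y). X x y)" "smooth_plot n p" "smooth_plot n q"
  shows "smooth_plot n (\<lambda>t. X (p t) (q t))"
  using smoothD[OF assms(1) smooth_plot_Pair[OF assms(2,3)]] by simp

section \<open>Mixed derivatives and diagonals\<close>

text \<open>The mean value property is applied twice: in \<open>y\<close> to \<open>fx x\<close>,
  then in \<open>x\<close> to the scaled difference of \<open>f\<close> between \<open>b\<close> and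
  \<open>b + e\<close>, whose derivatives the first application has placed in
  \<open>U\<close>.\<close>

lemma mixed_difference_mem:
  assumes "e > 0" "open U" "convex U"
    and fx: "\<And>x y. has_curve_deriv (\<lambda>x. f x y) (fx x y) x"
    and fxy: "\<And>x y. has_curve_deriv (fx x) (fxy x y) y"
    and mem: "\<And>x y. x \<in> {a..a + e} \<Longrightarrow> y \<in> {b..b + e} \<Longrightarrow> fxy x y \<in> U"
  shows "(1 / e) *\<^sub>R (1 / e) *\<^sub>R ((f (a + e) (b + e) - f (a + e) b) - (f a (b + e) - f a b)) \<in> U"
proof -
  have "(1 / (b + e - b)) *\<^sub>R (fx x (b + e) - fx x b) \<in> U" if "x \<in> {a..a + e}" for x
  proof (rule curve_mean_value_less)
    show "\<exists>d\<in>U. has_curve_deriv (fx x) d t" if "b \<le> t" "t \<le> b + e" for t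
      using fxy mem[of x t] that \<open>x \<in> {a..a + e}\<close> by auto
  qed (use assms in auto)
  then have "(1 / e) *\<^sub>R (fx x (b + e) - fx x b) \<in> U" if "x \<in> {a..a + e}" for x
    using that by simp
  moreover have "has_curve_deriv (\<lambda>x. (1 / e) *\<^sub>R (f x (b + e) - f x b)) ((1 / e) *\<^sub>R (fx x (b + e) - fx x b)) x" for x
    by (intro has_curve_deriv_scaleR_const has_curve_deriv_diff fx)
  ultimately have "(1 / (a + e - a)) *\<^sub>R ((1 / e) *\<^sub>R (f (a + e) (b + e) - f (a + e) b) - (1 / e) *\<^sub>R (f a (b + e) - f a b)) \<in> U"
    using assms(1-3) by (intro curve_mean_value_less) (simp_all, blast)
  then show ?thesis by (simp add: scaleR_right_diff_distrib)
qed

text \<open>Schwarz's theorem by separation: distinct values would have disjoint convex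
  neighbourhoods, yet on a small square one and the same second difference quotient lies in
  both.\<close>

lemma mixed_derivs_eq:
  fixes f :: "real \<Rightarrow> real \<Rightarrow> 'a::locally_convex_space"
  assumes fx: "\<And>x y. has_curve_deriv (\<lambda>x. f x y) (fx x y) x"
    and fy: "\<And>x y. has_curve_deriv (f x) (fy x y) y"
    and fxy: "\<And>x y. has_curve_deriv (fx x) (fxy x y) y"
    and fyx: "\<And>x y. has_curve_deriv (\<lambda>x. fy x y) (fyx x y) x"
    and cont: "continuous_on UNIV (\<lambda>z. fxy (fst z) (snd z))" "continuous_on UNIV (\<lambda>z. fyx (fst z) (snd z))"
  shows "fxy a b = fyx a b"
proof (rule ccontr)
  assume "fxy a b \<noteq> fyx a b"
  then obtain U V where UV: "open U" "open V" "fxy a b \<in> U" "fyx a b \<in> V" "U \<inter> V = {}"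
    using hausdorff by metis
  obtain C where C: "open C" "convex C" "fxy a b \<in> C" "C \<subseteq> U"
    using convex_nhds_base[OF UV(1,3)] by blast
  obtain D where D: "open D" "convex D" "fyx a b \<in> D" "D \<subseteq> V"
    using convex_nhds_base[OF UV(2,4)] by blast
  have "open ((\<lambda>z. fxy (fst z) (snd z)) -` C \<inter> (\<lambda>z. fyx (fst z) (snd z)) -` D)"
    using cont C D by (intro open_Int open_vimage)
  moreover have "(a, b) \<in> (\<lambda>z. fxy (fst z) (snd z)) -` C \<inter> (\<lambda>z. fyx (fst z) (snd z)) -` D"
    using C D by simp
  ultimately obtain A B where AB: "open A" "open B" "(a, b) \<in> A \<times> B"
      "A \<times> B \<subseteq> (\<lambda>z. fxy (fst z) (snd z)) -` C \<inter> (\<lambda>z. fyx (fst z) (snd z)) -` D"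
    by (rule open_prod_elim)
  obtain e1 e2 where e: "e1 > 0" "cball a e1 \<subseteq> A" "e2 > 0" "cball b e2 \<subseteq> B"
    using AB open_contains_cball by (metis SigmaD1 SigmaD2)
  define e where "e = min e1 e2"
  have mem: "fxy x y \<in> C \<and> fyx x y \<in> D" if "x \<in> {a..a + e}" "y \<in> {b..b + e}" for x y
  proof -
    have "x \<in> cball a e1" "y \<in> cball b e2" using that by (auto simp: e_def dist_real_def)
    then have "(x, y) \<in> A \<times> B" using e by blast
    then show ?thesis using AB(4) by auto
  qed
  have "e > 0" using e by (simp add: e_def)
  have "(1 / e) *\<^sub>R (1 / e) *\<^sub>R ((f (a + e) (b + e) - f (a + e) b) - (f a (b + e) - f a b)) \<in> C"
    by (rule mixed_difference_mem[OF \<open>e > 0\<close> C(1,2) fx fxy]) (use mem in blast)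
  \<comment> \<open>The same lemma with the roles of \<open>x\<close> and \<open>y\<close>
    exchanged; regrouping the four terms gives the quotient already found in
    \<open>C\<close>.\<close>
  moreover have "(1 / e) *\<^sub>R (1 / e) *\<^sub>R ((f (a + e) (b + e) - f a (b + e)) - (f (a + e) b - f a b)) \<in> D"
    by (rule mixed_difference_mem[OF \<open>e > 0\<close> D(1,2), where f = "\<lambda>y x. f x y", OF fy fyx]) (use mem in blast)
  ultimately show False
    using C D UV by (auto simp: algebra_simps)
qed

lemma continuous_on_fun_upd2:
  "continuous_on UNIV (\<lambda>z::real \<times> real. (t::nat \<Rightarrow> real)(i := fst z, j := snd z))"
proof (rule continuous_on_coordinatewise_then_product)
  fix k
  show "continuous_on UNIV (\<lambda>z::real \<times> real. (t(i := fst z, j := snd z)) k)"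
    by (cases "k = j"; cases "k = i") (simp_all add: continuous_intros)
qed

lemma smooth_plot_continuous2:
  assumes "smooth_plot n p"
  shows "continuous_on UNIV (\<lambda>z. p (t(i := fst z, j := snd z)))"
  using continuous_on_compose2[OF smooth_plot_continuous[OF assms] continuous_on_fun_upd2] by simp

text \<open>Freezing all coordinates except \<open>i\<close> and \<open>j\<close> reduces the claim
  to a function of two real variables.\<close>

lemma partial_deriv_commute:
  fixes p :: "_ \<Rightarrow> 'a::locally_convex_space"
  assumes p: "smooth_plot n p" and i: "i < n" and j: "j < n"
  shows "partial_deriv i (partial_deriv j p) = partial_deriv j (partial_deriv i p)"
proof (cases "i = j")
  case False
  show ?thesis
  proof
    fix t :: "nat \<Rightarrow> real"
    let ?u = "\<lambda>x y. t(i := x, j := y)"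
    have 1: "has_curve_deriv (\<lambda>x. q (?u x y)) (partial_deriv i q (?u x y)) x" if "smooth_plot n q" for q :: "_ \<Rightarrow> 'a" and x y
      using smooth_plot_has_deriv[OF that i, of "t(j := y)" x] False by (simp add: fun_upd_twist)
    have 2: "has_curve_deriv (\<lambda>y. q (?u x y)) (partial_deriv j q (?u x y)) y" if "smooth_plot n q" for q :: "_ \<Rightarrow> 'a" and x y
      using smooth_plot_has_deriv[OF that j, of "t(i := x)" y] .
    note s = smooth_plot_partial_deriv[OF p i] smooth_plot_partial_deriv[OF p j]
    note c = smooth_plot_continuous2[OF smooth_plot_partial_deriv[OF s(1) j]]
      smooth_plot_continuous2[OF smooth_plot_partial_deriv[OF s(2) i]]
    have "partial_deriv j (partial_deriv i p) (?u (t i) (t j)) = partial_deriv i (partial_deriv j p) (?u (t i) (t j))"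
      by (rule mixed_derivs_eq[where f = "\<lambda>x y. p (?u x y)" and fx = "\<lambda>x y. partial_deriv i p (?u x y)"
            and fy = "\<lambda>x y. partial_deriv j p (?u x y)"])
        (intro 1 2 p s c)+
    then show "partial_deriv i (partial_deriv j p) t = partial_deriv j (partial_deriv i p) t"
      by simp
  qed
qed simp

text \<open>The increment is \<open>f h h - f 0 h\<close> plus \<open>f 0 h - f 0 0\<close>. The
  second part gives \<open>d\<close>; the first is governed by the mean value property on the
  segment from 0 to \<open>h\<close> and joint continuity of \<open>fx\<close>.\<close>

lemma has_curve_deriv_diagonal:
  assumes fx: "\<And>x y. has_curve_deriv (\<lambda>x. f x y) (fx x y) x"
    and cont: "continuous_on UNIV (\<lambda>z. fx (fst z) (snd z))"
    and d: "has_curve_deriv (f 0) d 0"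
  shows "has_curve_deriv (\<lambda>h. f h h) (fx 0 0 + d) 0"
proof -
  have "((\<lambda>h. (1 / h) *\<^sub>R (f h h - f 0 h)) \<longlongrightarrow> fx 0 0) (at 0)"
  proof (rule topological_tendstoI)
    fix U assume "open U" "fx 0 0 \<in> U"
    then obtain C where C: "open C" "convex C" "fx 0 0 \<in> C" "C \<subseteq> U"
      using convex_nhds_base by blast
    have "open ((\<lambda>z. fx (fst z) (snd z)) -` C)"
      using cont C by (intro open_vimage)
    moreover have "(0, 0) \<in> (\<lambda>z. fx (fst z) (snd z)) -` C"
      using C by simp
    ultimately obtain A B where AB: "open A" "open B" "(0, 0) \<in> A \<times> B" "A \<times> B \<subseteq> (\<lambda>z. fx (fst z) (snd z)) -` C"
      by (rule open_prod_elim)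
    obtain e1 e2 where e: "e1 > 0" "cball 0 e1 \<subseteq> A" "e2 > 0" "cball 0 e2 \<subseteq> B"
      using AB open_contains_cball by (metis SigmaD1 SigmaD2)
    have "(1 / (h - 0)) *\<^sub>R (f h h - f 0 h) \<in> C" if "h \<noteq> 0" "\<bar>h\<bar> < min e1 e2" for h
    proof (rule curve_mean_value)
      fix t assume "t \<in> closed_segment 0 h"
      then have "t \<in> cball 0 e1" "h \<in> cball 0 e2"
        using that by (auto simp: closed_segment_eq_real_ivl split: if_splits)
      then have "(t, h) \<in> A \<times> B" using e by blast
      then have "fx t h \<in> C" using AB(4) by auto
      then show "\<exists>d\<in>C. has_curve_deriv (\<lambda>x. f x h) d t" using fx by blast
    qed (use that C in auto)
    then show "\<forall>\<^sub>F h in at 0. (1 / h) *\<^sub>R (f h h - f 0 h) \<in> U"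
      using C(4) e(1,3) unfolding eventually_at by (intro exI[of _ "min e1 e2"]) auto
  qed
  from tendsto_add[OF this d[unfolded has_curve_deriv_def]] show ?thesis
    unfolding has_curve_deriv_def by (simp add: scaleR_right_distrib[symmetric])
qed

section \<open>Smooth curves and their Taylor coefficients\<close>

text \<open>Curves are encoded as plots in one coordinate, so the closure properties of plots carry
  over.\<close>

definition smooth_curve :: "(real \<Rightarrow> 'a::locally_convex_space) \<Rightarrow> bool" where
  "smooth_curve c \<longleftrightarrow> smooth_plot 1 (\<lambda>t. c (t 0))"

lemma partial_deriv_curve: "partial_deriv 0 (\<lambda>t. c (t 0)) = (\<lambda>t. curve_deriv c (t 0))"
  by (simp add: partial_deriv_def fun_eq_iff)

lemma smooth_curve_has_deriv:
  assumes "smooth_curve c"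
  shows "has_curve_deriv c (curve_deriv c x) x"
  using smooth_plot_has_deriv[OF assms[unfolded smooth_curve_def], of 0 "\<lambda>_. x" x]
  by (simp add: partial_deriv_curve)

lemma smooth_curve_deriv: "smooth_curve c \<Longrightarrow> smooth_curve (curve_deriv c)"
  unfolding smooth_curve_def using smooth_plot_partial_deriv[of 1 "\<lambda>t. c (t 0)" 0]
  by (simp add: partial_deriv_curve)

lemma smooth_curve_deriv_iterate: "smooth_curve c \<Longrightarrow> smooth_curve ((curve_deriv ^^ k) c)"
  by (induction k) (simp_all add: smooth_curve_deriv)

text \<open>Each \<open>r j\<close> is continuous because it is differentiable, so the sequence
  itself is a class closed under derivatives. It is the route to smoothness of the remainder in
  Hadamard's lemma.\<close>

lemma smooth_curveI_derivs:
  fixes r :: "nat \<Rightarrow> real \<Rightarrow> 'a::locally_convex_space"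
  assumes "\<And>j x. has_curve_deriv (r j) (r (Suc j) x) x"
  shows "smooth_curve (r j)"
  unfolding smooth_curve_def
proof (rule smooth_plotI[where Q = "\<lambda>f. \<exists>j. f = (\<lambda>t. r j (t 0))"])
  fix f :: "(nat \<Rightarrow> real) \<Rightarrow> 'a" and i assume "\<exists>j. f = (\<lambda>t. r j (t 0))"
  then obtain j where f: "f = (\<lambda>t. r j (t 0))" by blast
  have "continuous_on UNIV (r j)"
    using has_curve_deriv_isCont[OF assms] by (simp add: continuous_at_imp_continuous_on)
  from continuous_on_compose2[OF this continuous_on_product_coordinates[of 0]] show "continuous_on UNIV f"
    unfolding f by simp
  assume "i < (1::nat)"
  then show "\<exists>g. (\<exists>j. g = (\<lambda>t. r j (t 0))) \<and> (\<forall>t. has_curve_deriv (\<lambda>s. f (t(i := s))) (g t) (t i))"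
    using assms unfolding f by (intro exI[of _ "\<lambda>t. r (Suc j) (t 0)"]) auto
qed auto

lemma smooth_curve_const: "smooth_curve (\<lambda>_. a)"
  by (simp add: smooth_curve_def smooth_plot_const)

lemma smooth_curve_add: "smooth_curve c \<Longrightarrow> smooth_curve c' \<Longrightarrow> smooth_curve (\<lambda>x. c x + c' x)"
  by (simp add: smooth_curve_def smooth_plot_add)

lemma smooth_curve_sum: "(\<And>i. i \<in> I \<Longrightarrow> smooth_curve (c i)) \<Longrightarrow> smooth_curve (\<lambda>x. \<Sum>i\<in>I. c i x)"
  by (simp add: smooth_curve_def smooth_plot_sum)

lemma smooth_curve_scaleR: "smooth_curve a \<Longrightarrow> smooth_curve c \<Longrightarrow> smooth_curve (\<lambda>x. a x *\<^sub>R c x)"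
  by (simp add: smooth_curve_def smooth_plot_scaleR)

lemma smooth_curve_power: "smooth_curve (\<lambda>x::real. x ^ k)"
  by (simp add: smooth_curve_def smooth_plot_power smooth_plot_coord)

lemma smooth_curve_power_scaleR: "smooth_curve c \<Longrightarrow> smooth_curve (\<lambda>x. x ^ k *\<^sub>R c x)"
  by (rule smooth_curve_scaleR[OF smooth_curve_power])

lemma smooth_curve_compose: "smooth X \<Longrightarrow> smooth_curve c \<Longrightarrow> smooth_curve (\<lambda>x. X (c x))"
  unfolding smooth_curve_def by (rule smoothD)

lemma smooth_curve_compose2:
  "smooth (\<lambda>(x, y). X x y) \<Longrightarrow> smooth_curve c \<Longrightarrow> smooth_curve c' \<Longrightarrow> smooth_curve (\<lambda>x. X (c x) (c' x))"
  unfolding smooth_curve_def by (rule smoothD2)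

lemma has_curve_deriv_eventually_eq:
  assumes "has_curve_deriv c d x" "\<forall>\<^sub>F y in nhds x. c y = c' y"
  shows "has_curve_deriv c' d x"
proof -
  have "filterlim (\<lambda>h. x + h) (nhds x) (at 0)"
    by (auto intro!: tendsto_eq_intros)
  then have ev: "\<forall>\<^sub>F h in at 0. c (x + h) = c' (x + h)"
    using assms(2) unfolding filterlim_iff by blast
  moreover have "c x = c' x"
    using assms(2) by (rule eventually_nhds_x_imp_x)
  ultimately have "\<forall>\<^sub>F h in at 0. (1 / h) *\<^sub>R (c (x + h) - c x) = (1 / h) *\<^sub>R (c' (x + h) - c' x)"
    by (auto elim: eventually_mono)
  then show ?thesis
    using assms(1) unfolding has_curve_deriv_def by (rule Lim_transform_eventually[rotated])
qed

text \<open>A form of L'Hospital's rule. Subtracting the leading term leaves \<open>G\<close> with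
  derivative \<open>x ^ m\<close> times a factor vanishing at 0, and the mean value property shows
  that \<open>G\<close> is of smaller order than \<open>x ^ Suc m\<close>.\<close>

lemma tendsto_divide_power_Suc:
  fixes F :: "real \<Rightarrow> 'a::locally_convex_space"
  assumes "F 0 = 0"
    and F: "\<And>x. has_curve_deriv F (x ^ m *\<^sub>R v x) x"
    and v: "(v \<longlongrightarrow> v 0) (at 0)"
  shows "((\<lambda>x. (1 / x ^ Suc m) *\<^sub>R F x) \<longlongrightarrow> (1 / real (Suc m)) *\<^sub>R v 0) (at 0)"
proof -
  define G where "G x = F x - x ^ Suc m *\<^sub>R ((1 / real (Suc m)) *\<^sub>R v 0)" for x
  have G: "has_curve_deriv G (x ^ m *\<^sub>R (v x - v 0)) x" for x
    using has_curve_deriv_diff[OF F[of x] has_curve_deriv_scaleR[OF has_curve_deriv_power[of "Suc m"]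
          has_curve_deriv_const[of "(1 / real (Suc m)) *\<^sub>R v 0"]]]
    unfolding G_def by (simp add: scaleR_right_diff_distrib del: of_nat_Suc)
  have "((\<lambda>x. (1 / x ^ Suc m) *\<^sub>R G x) \<longlongrightarrow> 0) (at 0)"
  proof (rule topological_tendstoI)
    fix U :: "'a set" assume "open U" "0 \<in> U"
    then obtain C where C: "open C" "convex C" "0 \<in> C" "C \<subseteq> U"
      using convex_nhds_base by blast
    have "((\<lambda>x. v x - v 0) \<longlongrightarrow> 0) (at 0)"
      using tendsto_add[OF v tendsto_const[of "- v 0"]] by simp
    then have "\<forall>\<^sub>F x in at 0. v x - v 0 \<in> C"
      using C by (auto dest: topological_tendstoD)
    then obtain e where e: "e > 0" "\<And>x. x \<noteq> 0 \<Longrightarrow> \<bar>x\<bar> < e \<Longrightarrow> v x - v 0 \<in> C"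
      unfolding eventually_at by (auto simp: dist_real_def)
    have vC: "v x - v 0 \<in> C" if "\<bar>x\<bar> < e" for x
      using e(2)[of x] that C(3) by (cases "x = 0") auto
    have "(1 / x ^ Suc m) *\<^sub>R G x \<in> C" if x: "x \<noteq> 0" "\<bar>x\<bar> < e" for x
    proof -
      \<comment> \<open>With \<open>x\<close> fixed in the factor \<open>1 / x ^ m\<close>, the
        difference quotient over the segment from 0 to \<open>x\<close> supplies the missing power
        of \<open>x\<close>.\<close>
      have "(1 / (x - 0)) *\<^sub>R ((1 / x ^ m) *\<^sub>R G x - (1 / x ^ m) *\<^sub>R G 0) \<in> C"
      proof (rule curve_mean_value)
        fix t assume "t \<in> closed_segment 0 x"
        then have t: "0 \<le> t / x" "t / x \<le> 1" "\<bar>t\<bar> < e"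
          using x by (auto simp: closed_segment_eq_real_ivl divide_simps split: if_splits)
        \<comment> \<open>The scaled derivative at \<open>t\<close> is a convex combination of
          \<open>v t - v 0\<close> and 0, since \<open>t / x\<close> lies between 0 and 1.\<close>
        have "(t / x) ^ m *\<^sub>R (v t - v 0) + (1 - (t / x) ^ m) *\<^sub>R 0 \<in> C"
          using t vC[of t] C by (intro convexD) (auto simp: power_le_one)
        then have "(1 / x ^ m) *\<^sub>R (t ^ m *\<^sub>R (v t - v 0)) \<in> C"
          by (simp add: power_divide)
        then show "\<exists>d\<in>C. has_curve_deriv (\<lambda>x'. (1 / x ^ m) *\<^sub>R G x') d t"
          using has_curve_deriv_scaleR_const[OF G] by blast
      qed (use x C in auto)
      moreover have "G 0 = 0" using assms(1) by (simp add: G_def)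
      ultimately show ?thesis by (simp add: mult.commute)
    qed
    then show "\<forall>\<^sub>F x in at 0. (1 / x ^ Suc m) *\<^sub>R G x \<in> U"
      using e(1) C(4) unfolding eventually_at by (intro exI[of _ e]) auto
  qed
  from tendsto_add[OF this tendsto_const[of "(1 / real (Suc m)) *\<^sub>R v 0"]]
  have "((\<lambda>x. (1 / x ^ Suc m) *\<^sub>R G x + (1 / real (Suc m)) *\<^sub>R v 0) \<longlongrightarrow> (1 / real (Suc m)) *\<^sub>R v 0) (at 0)"
    by simp
  moreover have "\<forall>\<^sub>F x in at 0. (1 / x ^ Suc m) *\<^sub>R G x + (1 / real (Suc m)) *\<^sub>R v 0 = (1 / x ^ Suc m) *\<^sub>R F x"
    unfolding eventually_at_filter G_def
    by (intro always_eventually) (simp add: scaleR_right_diff_distrib del: of_nat_Suc power_Suc)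
  ultimately show ?thesis by (rule Lim_transform_eventually)
qed

text \<open>
  Hadamard's lemma.  The \<open>j\<close>-th derivative of the quotient is \<open>\<integral>\<^sub>0\<^sup>1 s\<^sup>j c\<^sup>(\<^sup>j\<^sup>+\<^sup>1\<^sup>)(s x) ds\<close>; since the space
  need not be complete, the integral is replaced by \<open>R j x / x\<^sup>j\<^sup>+\<^sup>1\<close>, where \<open>R j\<close> is what
  integration by parts gives for the antiderivative of \<open>x\<^sup>j c\<^sup>(\<^sup>j\<^sup>+\<^sup>1\<^sup>)(x)\<close>.
\<close>

lemma hadamard:
  assumes c: "smooth_curve c"
  obtains r where "smooth_curve r" "\<And>x. c x = c 0 + x *\<^sub>R r x"
proof -
  define D where "D j = (curve_deriv ^^ j) c" for j
  have D: "has_curve_deriv (D j) (D (Suc j) x) x" for j x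
    using smooth_curve_has_deriv[OF smooth_curve_deriv_iterate[OF c]] by (simp add: D_def)
  define R where "R = rec_nat (\<lambda>x. c x - c 0) (\<lambda>j Rj x. x ^ Suc j *\<^sub>R D (Suc j) x - real (Suc j) *\<^sub>R Rj x)"
  have R0: "R 0 = (\<lambda>x. c x - c 0)"
    and RS: "R (Suc j) = (\<lambda>x. x ^ Suc j *\<^sub>R D (Suc j) x - real (Suc j) *\<^sub>R R j x)" for j
    by (simp_all add: R_def)
  have Rz: "R j 0 = 0" for j
    by (induction j) (simp_all add: R0 RS)
  have R: "has_curve_deriv (R j) (x ^ j *\<^sub>R D (Suc j) x) x" for j x
  proof (induction j)
    case 0
    then show ?case
      using has_curve_deriv_diff[OF D[of 0] has_curve_deriv_const[of "c 0"]] by (simp add: R0 D_def)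
  next
    case (Suc j)
    show ?case
      using has_curve_deriv_diff[OF has_curve_deriv_scaleR[OF has_curve_deriv_power[of "Suc j"] D[of "Suc j"]]
          has_curve_deriv_scaleR_const[OF Suc, of "real (Suc j)"]]
      unfolding RS by (simp del: of_nat_Suc power_Suc)
  qed
  \<comment> \<open>At \<open>x = 0\<close> the integral form has the constant factor
    \<open>D (Suc j) 0\<close>, and the power of \<open>s\<close> integrates to
    \<open>1 / real (Suc j)\<close>.\<close>
  define r where "r j x = (if x = 0 then (1 / real (Suc j)) *\<^sub>R D (Suc j) 0 else (1 / x ^ Suc j) *\<^sub>R R j x)" for j x
  have "has_curve_deriv (r j) (r (Suc j) x) x" for j x
  proof (cases "x = 0")
    case False
    have "x * x ^ (n - Suc 0) = x ^ n" if "n \<noteq> 0" for n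
      using that by (cases n) auto
    then have "has_curve_deriv (\<lambda>x. 1 / x ^ Suc j) (- (real (Suc j) / x ^ Suc (Suc j))) x"
      unfolding has_curve_deriv_iff_has_vector_derivative has_real_derivative_iff_has_vector_derivative[symmetric]
      using False by (cases j) (auto intro!: derivative_eq_intros simp: field_simps, blast?)
    \<comment> \<open>Away from 0, the quotient rule reproduces exactly the recursion that defines
      \<open>R (Suc j)\<close>.\<close>
    from has_curve_deriv_scaleR[OF this R]
    have "has_curve_deriv (\<lambda>x. (1 / x ^ Suc j) *\<^sub>R R j x)
        ((1 / x ^ Suc j) *\<^sub>R (x ^ j *\<^sub>R D (Suc j) x) + (- (real (Suc j) / x ^ Suc (Suc j))) *\<^sub>R R j x) x" .
    moreover have "(1 / x ^ Suc j) *\<^sub>R (x ^ j *\<^sub>R D (Suc j) x) + (- (real (Suc j) / x ^ Suc (Suc j))) *\<^sub>R R j x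
        = r (Suc j) x"
      using False by (simp add: r_def RS scaleR_right_diff_distrib divide_simps del: of_nat_Suc)
    moreover have "\<forall>\<^sub>F y in nhds x. (1 / y ^ Suc j) *\<^sub>R R j y = r j y"
      using t1_space_nhds[OF False] by (rule eventually_mono) (simp add: r_def)
    ultimately show ?thesis
      using has_curve_deriv_eventually_eq by metis
  next
    case True
    \<comment> \<open>\<open>v\<close> is the difference quotient of \<open>D (Suc j)\<close> at 0,
      completed by its limit.\<close>
    define v where "v x = (if x = 0 then D (Suc (Suc j)) 0 else (1 / x) *\<^sub>R (D (Suc j) x - D (Suc j) 0))" for x
    have "((\<lambda>h. (1 / h) *\<^sub>R (D (Suc j) (0 + h) - D (Suc j) 0)) \<longlongrightarrow> v 0) (at 0)"
      using D[of "Suc j" 0] unfolding has_curve_deriv_def v_def by simp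
    then have v: "(v \<longlongrightarrow> v 0) (at 0)"
      by (rule Lim_transform_eventually) (simp add: eventually_at_filter v_def)
    \<comment> \<open>\<open>F\<close> is \<open>R j\<close> without its leading term, so that
      \<open>F h\<close> divided by \<open>h ^ Suc (Suc j)\<close> is the difference quotient of
      \<open>r j\<close> at 0; its derivative has the shape required by the limit rule.\<close>
    define F where "F x = R j x - x ^ Suc j *\<^sub>R ((1 / real (Suc j)) *\<^sub>R D (Suc j) 0)" for x
    have "has_curve_deriv F (x ^ j *\<^sub>R (D (Suc j) x - D (Suc j) 0)) x" for x
      using has_curve_deriv_diff[OF R[of j x] has_curve_deriv_scaleR[OF has_curve_deriv_power[of "Suc j"]
            has_curve_deriv_const[of "(1 / real (Suc j)) *\<^sub>R D (Suc j) 0"]]]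
      unfolding F_def by (simp add: scaleR_right_diff_distrib del: of_nat_Suc)
    moreover have "x ^ j *\<^sub>R (D (Suc j) x - D (Suc j) 0) = x ^ Suc j *\<^sub>R v x" for x
      by (simp add: v_def)
    ultimately have F: "has_curve_deriv F (x ^ Suc j *\<^sub>R v x) x" for x
      by metis
    have "F 0 = 0" by (simp add: F_def Rz)
    then have "((\<lambda>x. (1 / x ^ Suc (Suc j)) *\<^sub>R F x) \<longlongrightarrow> (1 / real (Suc (Suc j))) *\<^sub>R v 0) (at 0)"
      by (rule tendsto_divide_power_Suc[OF _ F v])
    moreover have "(1 / h ^ Suc (Suc j)) *\<^sub>R F h = (1 / h) *\<^sub>R (r j (0 + h) - r j 0)" if "h \<noteq> 0" for h
      using that by (simp add: F_def r_def scaleR_right_diff_distrib del: of_nat_Suc)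
    then have "\<forall>\<^sub>F h in at 0. (1 / h ^ Suc (Suc j)) *\<^sub>R F h = (1 / h) *\<^sub>R (r j (0 + h) - r j 0)"
      by (simp add: eventually_at_filter)
    ultimately have "((\<lambda>h. (1 / h) *\<^sub>R (r j (0 + h) - r j 0)) \<longlongrightarrow> (1 / real (Suc (Suc j))) *\<^sub>R v 0) (at 0)"
      by (rule Lim_transform_eventually)
    then show ?thesis
      unfolding has_curve_deriv_def True by (simp add: r_def v_def)
  qed
  then have "smooth_curve (r 0)" by (rule smooth_curveI_derivs)
  moreover have "c x = c 0 + x *\<^sub>R r 0 x" for x
    by (simp add: r_def R0)
  ultimately show ?thesis using that by blast
qed

section \<open>Algebra of Taylor coefficients\<close>

lemma curve_deriv_iterate_add:
  assumes "smooth_curve c" "smooth_curve c'"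
  shows "(curve_deriv ^^ k) (\<lambda>x. c x + c' x) = (\<lambda>x. (curve_deriv ^^ k) c x + (curve_deriv ^^ k) c' x)"
proof (induction k)
  case (Suc k)
  show ?case
    unfolding funpow.simps comp_apply Suc
    by (intro curve_deriv_eqI has_curve_deriv_add smooth_curve_has_deriv smooth_curve_deriv_iterate assms)
qed simp

lemma curve_deriv_iterate_scaleR:
  assumes "smooth_curve c"
  shows "(curve_deriv ^^ k) (\<lambda>x. r *\<^sub>R c x) = (\<lambda>x. r *\<^sub>R (curve_deriv ^^ k) c x)"
proof (induction k)
  case (Suc k)
  show ?case
    unfolding funpow.simps comp_apply Suc
    by (intro curve_deriv_eqI has_curve_deriv_scaleR_const smooth_curve_has_deriv smooth_curve_deriv_iterate assms)
qed simp

text \<open>The Leibniz formula has only two terms here because the second derivative of the factor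
  \<open>x\<close> vanishes.\<close>

lemma curve_deriv_iterate_ident_scaleR:
  assumes "smooth_curve c"
  shows "(curve_deriv ^^ Suc k) (\<lambda>x. x *\<^sub>R c x) =
    (\<lambda>x. x *\<^sub>R (curve_deriv ^^ Suc k) c x + real (Suc k) *\<^sub>R (curve_deriv ^^ k) c x)"
proof (induction k)
  case 0
  show ?case
    using has_curve_deriv_scaleR[OF has_curve_deriv_ident smooth_curve_has_deriv[OF assms]]
    by (simp add: curve_deriv_eqI)
next
  case (Suc k)
  define D where "D k = (curve_deriv ^^ k) c" for k
  have D: "has_curve_deriv (D k) (D (Suc k) x) x" for k x
    using smooth_curve_has_deriv[OF smooth_curve_deriv_iterate[OF assms]] by (simp add: D_def)
  have "has_curve_deriv (\<lambda>x. x *\<^sub>R D (Suc k) x + real (Suc k) *\<^sub>R D k x)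
      ((x *\<^sub>R D (Suc (Suc k)) x + 1 *\<^sub>R D (Suc k) x) + real (Suc k) *\<^sub>R D (Suc k) x) x" for x
    by (intro has_curve_deriv_add has_curve_deriv_scaleR has_curve_deriv_scaleR_const has_curve_deriv_ident D)
  moreover have "(x *\<^sub>R D (Suc (Suc k)) x + 1 *\<^sub>R D (Suc k) x) + real (Suc k) *\<^sub>R D (Suc k) x =
      x *\<^sub>R D (Suc (Suc k)) x + real (Suc (Suc k)) *\<^sub>R D (Suc k) x" for x
    by (simp add: algebra_simps scaleR_2)
  ultimately have "curve_deriv (\<lambda>x. x *\<^sub>R D (Suc k) x + real (Suc k) *\<^sub>R D k x) =
      (\<lambda>x. x *\<^sub>R D (Suc (Suc k)) x + real (Suc (Suc k)) *\<^sub>R D (Suc k) x)"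
    by (intro curve_deriv_eqI) (simp only:)
  then show ?case
    unfolding D_def by (simp only: funpow.simps(2)[of "Suc k"] comp_apply Suc)
qed

lemma taylor_coeff_add:
  "smooth_curve c \<Longrightarrow> smooth_curve c' \<Longrightarrow>
    taylor_coeff k (\<lambda>x. c x + c' x) = taylor_coeff k c + taylor_coeff k c'"
  by (simp add: taylor_coeff_def curve_deriv_iterate_add scaleR_right_distrib)

lemma taylor_coeff_scaleR:
  "smooth_curve c \<Longrightarrow> taylor_coeff k (\<lambda>x. r *\<^sub>R c x) = r *\<^sub>R taylor_coeff k c"
  by (simp add: taylor_coeff_def curve_deriv_iterate_scaleR)

lemma taylor_coeff_const: "taylor_coeff k (\<lambda>_. a) = (if k = 0 then a else 0)"
proof -
  have "(curve_deriv ^^ Suc k) (\<lambda>_. a) = (\<lambda>_. 0)" for k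
    by (induction k) (simp_all add: curve_deriv_eqI has_curve_deriv_const)
  then show ?thesis
    by (cases k) (simp_all only: taylor_coeff_def, simp_all)
qed

lemma taylor_coeff_sum:
  "(\<And>i. i \<in> I \<Longrightarrow> smooth_curve (c i)) \<Longrightarrow>
    taylor_coeff k (\<lambda>x. \<Sum>i\<in>I. c i x) = (\<Sum>i\<in>I. taylor_coeff k (c i))"
  by (induction I rule: infinite_finite_induct)
    (simp_all add: taylor_coeff_const taylor_coeff_add smooth_curve_sum)

text \<open>At 0 only the second term of the Leibniz formula survives, and its factor
  \<open>Suc k\<close> is absorbed by the factorial.\<close>

lemma taylor_coeff_ident_scaleR:
  assumes "smooth_curve c"
  shows "taylor_coeff 0 (\<lambda>x. x *\<^sub>R c x) = 0" "taylor_coeff (Suc k) (\<lambda>x. x *\<^sub>R c x) = taylor_coeff k c"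
  using curve_deriv_iterate_ident_scaleR[OF assms, of k]
  by (simp_all add: taylor_coeff_def del: funpow.simps(2) of_nat_Suc)

lemma taylor_coeff_power_scaleR:
  assumes "smooth_curve c"
  shows "taylor_coeff k (\<lambda>x. x ^ b *\<^sub>R c x) = (if k < b then 0 else taylor_coeff (k - b) c)"
proof (induction b arbitrary: k)
  case (Suc b)
  have "taylor_coeff k (\<lambda>x. x ^ Suc b *\<^sub>R c x) = taylor_coeff k (\<lambda>x. x *\<^sub>R (x ^ b *\<^sub>R c x))"
    by (simp only: power_Suc scaleR_scaleR)
  also have "\<dots> = (if k = 0 then 0 else taylor_coeff (k - 1) (\<lambda>x. x ^ b *\<^sub>R c x))"
    by (cases k) (simp_all add: taylor_coeff_ident_scaleR smooth_curve_power_scaleR assms del: scaleR_scaleR)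
  finally show ?case by (auto simp: Suc)
qed simp

text \<open>Hadamard's lemma is iterated: the quotient \<open>q\<close> has the coefficients of
  \<open>c\<close> shifted down by one, and the remainder of \<open>q\<close> serves for
  \<open>c\<close>.\<close>

lemma taylor_expansion:
  assumes "smooth_curve c"
  obtains r where "smooth_curve r" "\<And>x. c x = (\<Sum>b<m. x ^ b *\<^sub>R taylor_coeff b c) + x ^ m *\<^sub>R r x"
proof -
  have "\<exists>r. smooth_curve r \<and> (\<forall>x. c x = (\<Sum>b<m. x ^ b *\<^sub>R taylor_coeff b c) + x ^ m *\<^sub>R r x)"
    using assms
  proof (induction m arbitrary: c)
    case 0
    then show ?case by (intro exI[of _ c]) simp
  next
    case (Suc m)
    obtain q where q: "smooth_curve q" "\<And>x. c x = c 0 + x *\<^sub>R q x"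
      using hadamard[OF Suc.prems] by blast
    obtain r where r: "smooth_curve r" "\<And>x. q x = (\<Sum>b<m. x ^ b *\<^sub>R taylor_coeff b q) + x ^ m *\<^sub>R r x"
      using Suc.IH[OF q(1)] by blast
    have "smooth_curve (\<lambda>x. x *\<^sub>R q x)"
      using smooth_curve_power_scaleR[OF q(1), of 1] by simp
    then have "taylor_coeff (Suc b) (\<lambda>x. c 0 + x *\<^sub>R q x) = taylor_coeff b q" for b
      by (simp add: taylor_coeff_add taylor_coeff_const smooth_curve_const taylor_coeff_ident_scaleR q(1))
    moreover have "(\<lambda>x. c 0 + x *\<^sub>R q x) = c" by (intro ext) (rule q(2)[symmetric])
    ultimately have t: "taylor_coeff (Suc b) c = taylor_coeff b q" for b by simp
    have "c x = (\<Sum>b<Suc m. x ^ b *\<^sub>R taylor_coeff b c) + x ^ Suc m *\<^sub>R r x" for x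
    proof -
      have "c x = c 0 + x *\<^sub>R ((\<Sum>b<m. x ^ b *\<^sub>R taylor_coeff b q) + x ^ m *\<^sub>R r x)"
        by (subst q(2), subst r(2)) (rule refl)
      also have "\<dots> = (\<Sum>b<Suc m. x ^ b *\<^sub>R taylor_coeff b c) + x ^ Suc m *\<^sub>R r x"
        by (subst sum.lessThan_Suc_shift)
          (simp add: t scaleR_right_distrib scaleR_sum_right, simp add: taylor_coeff_def)
      finally show ?thesis .
    qed
    with r(1) show ?case by blast
  qed
  then show ?thesis using that by blast
qed

text \<open>
  \<open>L\<close> is only assumed to act smoothly on curves, so it cannot be differentiated as an operator; but
  expanding \<open>c\<close> with a smooth remainder leaves only multiplication by powers of the parameter.
\<close>

lemma taylor_coeff_linear_family:
  assumes c: "smooth_curve c" and L: "\<And>x. linear (L x)"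
    and smooth: "\<And>r. smooth_curve r \<Longrightarrow> smooth_curve (\<lambda>x. L x (r x))"
  shows "taylor_coeff k (\<lambda>x. L x (c x)) = (\<Sum>b\<le>k. taylor_coeff (k - b) (\<lambda>x. L x (taylor_coeff b c)))"
proof -
  \<comment> \<open>The expansion goes one order beyond \<open>k\<close>, so the remainder carries
    \<open>x ^ Suc k\<close> and does not reach the coefficient of order \<open>k\<close>.\<close>
  obtain r where r: "smooth_curve r"
    "\<And>x. c x = (\<Sum>b<Suc k. x ^ b *\<^sub>R taylor_coeff b c) + x ^ Suc k *\<^sub>R r x"
    using taylor_expansion[OF c] by blast
  have const: "smooth_curve (\<lambda>x. L x a)" for a
    by (rule smooth[OF smooth_curve_const])
  have "L x (c x) = (\<Sum>b<Suc k. x ^ b *\<^sub>R L x (taylor_coeff b c)) + x ^ Suc k *\<^sub>R L x (r x)" for x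
    by (subst r(2)) (simp only: linear_add[OF L] linear_sum[OF L] linear_scale[OF L])
  then have "taylor_coeff k (\<lambda>x. L x (c x)) =
      taylor_coeff k (\<lambda>x. (\<Sum>b<Suc k. x ^ b *\<^sub>R L x (taylor_coeff b c)) + x ^ Suc k *\<^sub>R L x (r x))"
    by simp
  also have "\<dots> = (\<Sum>b<Suc k. taylor_coeff k (\<lambda>x. x ^ b *\<^sub>R L x (taylor_coeff b c))) +
      taylor_coeff k (\<lambda>x. x ^ Suc k *\<^sub>R L x (r x))"
    by (subst taylor_coeff_add, intro smooth_curve_sum smooth_curve_power_scaleR const,
        intro smooth_curve_power_scaleR smooth r, subst taylor_coeff_sum)
      (intro smooth_curve_power_scaleR const refl)+
  also have "\<dots> = (\<Sum>b\<le>k. taylor_coeff (k - b) (\<lambda>x. L x (taylor_coeff b c)))"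
    by (subst taylor_coeff_power_scaleR, intro smooth r)
      (auto simp: taylor_coeff_power_scaleR const lessThan_Suc_atMost intro!: sum.cong)
  finally show ?thesis .
qed

text \<open>The product formula involves only coefficients of \<open>c\<close> up to order
  \<open>k\<close>; curves may thus be exchanged modulo terms of order \<open>k + 1\<close>.\<close>

lemma taylor_coeff_linear_cong:
  assumes "smooth_curve c" "smooth_curve c'" "\<And>x. linear (L x)"
    and "\<And>r. smooth_curve r \<Longrightarrow> smooth_curve (\<lambda>x. L x (r x))"
    and "\<And>b. b \<le> k \<Longrightarrow> taylor_coeff b c = taylor_coeff b c'"
  shows "taylor_coeff k (\<lambda>x. L x (c x)) = taylor_coeff k (\<lambda>x. L x (c' x))"
  using assms by (simp add: taylor_coeff_linear_family)

lemma taylor_coeff_linear: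
  assumes "smooth_curve c" "linear L" "\<And>r. smooth_curve r \<Longrightarrow> smooth_curve (\<lambda>x. L (r x))"
  shows "taylor_coeff k (\<lambda>x. L (c x)) = L (taylor_coeff k c)"
proof -
  \<comment> \<open>For a constant family only the summand \<open>b = k\<close> survives, constants
    having no higher coefficients.\<close>
  have "taylor_coeff k (\<lambda>x. L (c x)) = (\<Sum>b\<le>k. if b = k then L (taylor_coeff b c) else 0)"
    by (subst taylor_coeff_linear_family[where L = "\<lambda>_. L", OF assms])
      (auto simp: taylor_coeff_const intro!: sum.cong)
  then show ?thesis by simp
qed

section \<open>Families of curves\<close>

lemma smooth_plot_partial_deriv_iterate:
  "smooth_plot n p \<Longrightarrow> i < n \<Longrightarrow> smooth_plot n ((partial_deriv i ^^ k) p)"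
  by (induction k) (simp_all add: smooth_plot_partial_deriv)

lemma curve_deriv_iterate_plot:
  assumes "smooth_plot n p" "i < n"
  shows "(curve_deriv ^^ k) (\<lambda>s. p (t(i := s))) = (\<lambda>s. (partial_deriv i ^^ k) p (t(i := s)))"
proof (induction k)
  case (Suc k)
  show ?case
    unfolding funpow.simps comp_apply Suc
    by (intro curve_deriv_eqI smooth_plot_has_deriv[OF smooth_plot_partial_deriv_iterate[OF assms] assms(2)])
qed simp

lemma partial_deriv_commute_iterate:
  assumes "smooth_plot n p" "i < n" "j < n"
  shows "partial_deriv i ((partial_deriv j ^^ k) p) = (partial_deriv j ^^ k) (partial_deriv i p)"
proof (induction k)
  case (Suc k)
  then show ?case
    using partial_deriv_commute[OF smooth_plot_partial_deriv_iterate[OF assms(1,3)] assms(2,3), of k] by simp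
qed simp

text \<open>The Taylor parameter becomes coordinate \<open>n\<close> of a joint plot. Its iterated
  derivative in that coordinate is then restricted to 0; \<open>dep\<close> ensures that
  \<open>F t\<close> itself does not see this coordinate.\<close>

lemma smooth_plot_taylor_coeff:
  assumes F: "smooth_plot (Suc n) (\<lambda>t. F t (t n))"
    and dep: "\<And>s t. (\<And>i. i < n \<Longrightarrow> s i = t i) \<Longrightarrow> F s = F t"
  shows "smooth_plot n (\<lambda>t. taylor_coeff k (F t))"
proof -
  define p where "p t = F t (t n)" for t
  have p: "smooth_plot (Suc n) p" using F by (simp add: p_def[abs_def])
  have F_eq: "F t = (\<lambda>s. p (t(n := s)))" for t
  proof
    fix x
    have "F t = F (t(n := x))" by (rule dep) simp
    then show "F t x = p (t(n := x))" by (simp add: p_def)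
  qed
  have "taylor_coeff k (F t) = (1 / fact k) *\<^sub>R (partial_deriv n ^^ k) p (t(n := 0))" for t
    unfolding taylor_coeff_def by (subst F_eq) (simp add: curve_deriv_iterate_plot[OF p])
  moreover have "smooth_plot n (\<lambda>t. (1 / fact k :: real) *\<^sub>R (partial_deriv n ^^ k) p (t(n := 0)))"
    by (intro smooth_plot_scaleR smooth_plot_const smooth_plot_restrict smooth_plot_partial_deriv_iterate p) simp
  ultimately show ?thesis by simp
qed

text \<open>Symmetry of mixed derivatives, with \<open>s\<close> as coordinate 0 and the Taylor
  parameter as coordinate 1.\<close>

lemma has_curve_deriv_taylor_coeff:
  assumes "smooth_plot 2 (\<lambda>t. f (t 0) (t 1))"
  shows "has_curve_deriv (\<lambda>s. taylor_coeff k (f s)) (taylor_coeff k (\<lambda>x. curve_deriv (\<lambda>s. f s x) s)) s"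
proof -
  define p where "p t = f (t 0) (t 1)" for t :: "nat \<Rightarrow> real"
  have p: "smooth_plot 2 p" using assms by (simp add: p_def[abs_def])
  have p': "smooth_plot 2 (partial_deriv 0 p)"
    by (rule smooth_plot_partial_deriv[OF p]) simp
  \<comment> \<open>\<open>u\<close> is only a background sequence: both coordinates read by
    \<open>p\<close> are overwritten.\<close>
  define u where "u = (\<lambda>_::nat. 0::real)"
  have f: "f s = (\<lambda>x. p ((u(0 := s))(1 := x)))"
    and f': "(\<lambda>x. curve_deriv (\<lambda>s. f s x) s) = (\<lambda>x. partial_deriv 0 p ((u(0 := s))(1 := x)))" for s
    by (simp_all add: p_def partial_deriv_def)
  have twist: "u(0 := s, 1 := 0) = u(1 := 0, 0 := s)" for s
    by (simp add: fun_upd_twist)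
  have "taylor_coeff k (f s) = (1 / fact k) *\<^sub>R (partial_deriv 1 ^^ k) p (u(1 := 0, 0 := s))" for s
    using curve_deriv_iterate_plot[OF p, of 1 k "u(0 := s)"] unfolding taylor_coeff_def f twist[symmetric]
    by simp
  moreover have "taylor_coeff k (\<lambda>x. curve_deriv (\<lambda>s. f s x) s) =
      (1 / fact k) *\<^sub>R partial_deriv 0 ((partial_deriv 1 ^^ k) p) (u(1 := 0, 0 := s))"
    using curve_deriv_iterate_plot[OF p', of 1 k "u(0 := s)"] partial_deriv_commute_iterate[OF p, of 0 1 k]
    unfolding taylor_coeff_def f' twist[symmetric] by simp
  ultimately show ?thesis
    using has_curve_deriv_scaleR_const[OF smooth_plot_has_deriv[OF smooth_plot_partial_deriv_iterate[OF p]]]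
    by simp
qed

section \<open>Gateaux derivatives of smooth maps\<close>

lemma smooth_fix_param:
  assumes "smooth (\<lambda>(v, x). X v x)"
  shows "smooth (\<lambda>v. X v x)"
  unfolding smooth_def comp_def by (intro allI impI smoothD2[OF assms] smooth_plot_const)

lemma has_curve_deriv_gateaux:
  assumes "smooth X"
  shows "has_curve_deriv (\<lambda>s. X (u + s *\<^sub>R S)) (gateaux X u S) 0"
proof -
  have "smooth_curve (\<lambda>s. X (u + s *\<^sub>R S))"
    unfolding smooth_curve_def
    by (intro smoothD[OF assms] smooth_plot_add smooth_plot_scaleR smooth_plot_const smooth_plot_coord) simp
  then show ?thesis
    unfolding gateaux_def by (rule smooth_curve_has_deriv)
qed

text \<open>Additivity is the diagonal rule for \<open>X (u + x *\<^sub>R a + y *\<^sub>R b)\<close>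
  at the origin; homogeneity is a change of parameter.\<close>

lemma linear_gateaux:
  assumes X: "smooth X"
  shows "linear (gateaux X u)"
proof (rule linearI)
  fix a b
  define p where "p t = X (u + t 0 *\<^sub>R a + t 1 *\<^sub>R b)" for t :: "nat \<Rightarrow> real"
  have p: "smooth_plot 2 p"
    unfolding p_def
    by (intro smoothD[OF X] smooth_plot_add smooth_plot_scaleR smooth_plot_const smooth_plot_coord) simp_all
  define e where "e x y = (\<lambda>_::nat. 0::real)(0 := x, 1 := y)" for x y
  have e: "e x y = ((\<lambda>_. 0)(1 := y))(0 := x)" for x y
    by (simp add: e_def fun_upd_twist)
  have p_e: "p (e x y) = X (u + x *\<^sub>R a + y *\<^sub>R b)" for x y
    by (simp add: p_def e_def)
  have fx: "has_curve_deriv (\<lambda>x. p (e x y)) (partial_deriv 0 p (e x y)) x" for x y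
    unfolding e by (rule smooth_plot_has_deriv[OF p]) simp
  have "has_curve_deriv (\<lambda>h. p (e h h)) (partial_deriv 0 p (e 0 0) + gateaux X u b) 0"
  proof (rule has_curve_deriv_diagonal[OF fx])
    show "continuous_on UNIV (\<lambda>z. partial_deriv 0 p (e (fst z) (snd z)))"
      unfolding e_def by (rule smooth_plot_continuous2[OF smooth_plot_partial_deriv[OF p]]) simp
    show "has_curve_deriv (\<lambda>y. p (e 0 y)) (gateaux X u b) 0"
      using has_curve_deriv_gateaux[OF X] by (simp add: p_e)
  qed
  moreover have "has_curve_deriv (\<lambda>x. p (e x 0)) (gateaux X u a) 0"
    using has_curve_deriv_gateaux[OF X] by (simp add: p_e)
  then have "partial_deriv 0 p (e 0 0) = gateaux X u a"
    using fx has_curve_deriv_imp_curve_deriv by metis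
  moreover have "p (e h h) = X (u + h *\<^sub>R (a + b))" for h
    by (simp add: p_e scaleR_right_distrib add.assoc)
  ultimately have "has_curve_deriv (\<lambda>h. X (u + h *\<^sub>R (a + b))) (gateaux X u a + gateaux X u b) 0"
    by simp
  then show "gateaux X u (a + b) = gateaux X u a + gateaux X u b"
    unfolding gateaux_def[of X u "a + b"] by (rule has_curve_deriv_imp_curve_deriv)
next
  fix r a
  have "has_curve_deriv (\<lambda>s. X (u + s *\<^sub>R r *\<^sub>R a)) (r *\<^sub>R gateaux X u a) 0"
    using has_curve_deriv_rescale[OF has_curve_deriv_gateaux[OF X, of u a], of r] by simp
  then show "gateaux X u (r *\<^sub>R a) = r *\<^sub>R gateaux X u a"
    unfolding gateaux_def[of X u "r *\<^sub>R a"] by (rule has_curve_deriv_imp_curve_deriv)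
qed

text \<open>The parameter along the direction is adjoined as coordinate \<open>n\<close>; the
  Gateaux derivative is the partial derivative there, restricted to 0.\<close>

lemma smooth_plot_gateaux:
  assumes X: "smooth (\<lambda>(v, x). X v x)"
    and u: "smooth_plot n u" and S: "smooth_plot n S" and x: "smooth_plot n x"
  shows "smooth_plot n (\<lambda>t. gateaux (\<lambda>v. X v (x t)) (u t) (S t))"
proof -
  define p where "p t = X (u t + t n *\<^sub>R S t) (x t)" for t
  have "smooth_plot (Suc n) u" "smooth_plot (Suc n) S" "smooth_plot (Suc n) x"
    using u S x by (auto intro: smooth_plot_weaken)
  then have p: "smooth_plot (Suc n) p"
    unfolding p_def
    by (intro smoothD2[OF X] smooth_plot_add smooth_plot_scaleR smooth_plot_coord) simp_all
  have "gateaux (\<lambda>v. X v (x t)) (u t) (S t) = partial_deriv n p (t(n := 0))" for t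
  proof -
    have "u (t(n := s)) = u t" "S (t(n := s)) = S t" "x (t(n := s)) = x t" for s
      by (rule smooth_plot_cong[OF u] smooth_plot_cong[OF S] smooth_plot_cong[OF x]; simp)+
    then show ?thesis
      by (simp add: partial_deriv_def p_def gateaux_def)
  qed
  then show ?thesis
    using smooth_plot_restrict[OF smooth_plot_partial_deriv[OF p]] by simp
qed

lemma smooth_curve_gateaux:
  assumes "smooth (\<lambda>(v, x). X v x)" "smooth_curve u" "smooth_curve S"
  shows "smooth_curve (\<lambda>x. gateaux (\<lambda>v. X v x) (u x) (S x))"
  using smooth_plot_gateaux[OF assms(1) assms(2,3)[unfolded smooth_curve_def] smooth_plot_coord]
  by (simp add: smooth_curve_def)

section \<open>Perturbation series\<close>

text \<open>The powers run opposite to those of \<open>pert_curve\<close>, so that covector and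
  vector components with the same index meet in order \<open>N\<close>.\<close>

definition pert_cocurve :: "nat \<Rightarrow> ('n \<Rightarrow> nat) \<Rightarrow> ('d::locally_convex_space) ^ 'n \<Rightarrow> real \<Rightarrow> 'd" where
  "pert_cocurve N idx \<beta> \<epsilon> = (\<Sum>i\<in>UNIV. \<epsilon> ^ (N - idx i) *\<^sub>R \<beta> $ i)"

text \<open>Varying component \<open>i\<close> of \<open>\<eta>\<close> contributes the power
  \<open>\<epsilon> ^ idx i\<close>, so the order \<open>N - idx i\<close> is what remains for
  \<open>G\<close>.\<close>

definition pert_gradient ::
    "nat \<Rightarrow> ('n \<Rightarrow> nat) \<Rightarrow> ('e::locally_convex_space \<Rightarrow> 'd::locally_convex_space) \<Rightarrow> 'e ^ 'n \<Rightarrow> 'd ^ 'n" where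
  "pert_gradient N idx G \<eta> = (\<chi> i. taylor_coeff (N - idx i) (\<lambda>\<epsilon>. G (pert_curve idx \<eta> \<epsilon>)))"

lemma smooth_plot_pert_curve:
  "smooth_plot n \<eta> \<Longrightarrow> smooth_plot n e \<Longrightarrow> smooth_plot n (\<lambda>t. pert_curve idx (\<eta> t) (e t))"
  unfolding pert_curve_def
  by (intro smooth_plot_sum smooth_plot_scaleR smooth_plot_power smooth_plot_vec_nth)

lemma smooth_plot_pert_cocurve:
  "smooth_plot n \<beta> \<Longrightarrow> smooth_plot n e \<Longrightarrow> smooth_plot n (\<lambda>t. pert_cocurve N idx (\<beta> t) (e t))"
  unfolding pert_cocurve_def
  by (intro smooth_plot_sum smooth_plot_scaleR smooth_plot_power smooth_plot_vec_nth)

lemma smooth_curve_pert_curve: "smooth_curve (pert_curve idx \<eta>)"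
  unfolding smooth_curve_def by (intro smooth_plot_pert_curve smooth_plot_const smooth_plot_coord) simp

lemma smooth_curve_pert_cocurve: "smooth_curve (pert_cocurve N idx \<beta>)"
  unfolding smooth_curve_def by (intro smooth_plot_pert_cocurve smooth_plot_const smooth_plot_coord) simp

lemma pert_curve_add_scaleR:
  "pert_curve idx (\<eta> + s *\<^sub>R S) \<epsilon> = pert_curve idx \<eta> \<epsilon> + s *\<^sub>R pert_curve idx S \<epsilon>"
  by (simp add: pert_curve_def scaleR_right_distrib sum.distrib scaleR_sum_right mult.commute)

lemma linear_pert_cocurve: "linear (\<lambda>\<beta>. pert_cocurve N idx \<beta> \<epsilon>)"
  by (rule linearI)
    (simp_all add: pert_cocurve_def scaleR_right_distrib sum.distrib scaleR_sum_right mult.commute)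

lemma smooth_plot_taylor_coeff_pert:
  assumes X: "smooth (\<lambda>(v, x). X v x)" and \<eta>: "smooth_plot n \<eta>" and \<beta>: "smooth_plot n \<beta>"
  shows "smooth_plot n (\<lambda>t. taylor_coeff k (\<lambda>\<epsilon>. X (pert_curve idx (\<eta> t) \<epsilon>) (pert_cocurve N idx (\<beta> t) \<epsilon>)))"
proof (rule smooth_plot_taylor_coeff)
  show "smooth_plot (Suc n) (\<lambda>t. X (pert_curve idx (\<eta> t) (t n)) (pert_cocurve N idx (\<beta> t) (t n)))"
    by (intro smoothD2[OF X] smooth_plot_pert_curve smooth_plot_pert_cocurve smooth_plot_coord
        smooth_plot_weaken[OF \<eta>] smooth_plot_weaken[OF \<beta>]) simp_all
next
  fix s t :: "nat \<Rightarrow> real" assume st: "\<And>i. i < n \<Longrightarrow> s i = t i"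
  show "(\<lambda>\<epsilon>. X (pert_curve idx (\<eta> s) \<epsilon>) (pert_cocurve N idx (\<beta> s) \<epsilon>)) =
      (\<lambda>\<epsilon>. X (pert_curve idx (\<eta> t) \<epsilon>) (pert_cocurve N idx (\<beta> t) \<epsilon>))"
    using smooth_plot_cong[OF \<eta> st] smooth_plot_cong[OF \<beta> st] by simp
qed

lemma smooth_taylor_coeff_pert_curve:
  fixes X :: "'e::locally_convex_space \<Rightarrow> 'b::locally_convex_space" and idx :: "'n::finite \<Rightarrow> nat"
  assumes X: "smooth X"
  shows "smooth (\<lambda>\<eta>. taylor_coeff k (\<lambda>\<epsilon>. X (pert_curve idx \<eta> \<epsilon>)))"
  unfolding smooth_def comp_def
proof (intro allI impI)
  fix n and p :: "_ \<Rightarrow> 'e ^ 'n" assume p: "smooth_plot n p"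
  show "smooth_plot n (\<lambda>t. taylor_coeff k (\<lambda>\<epsilon>. X (pert_curve idx (p t) \<epsilon>)))"
  proof (rule smooth_plot_taylor_coeff)
    show "smooth_plot (Suc n) (\<lambda>t. X (pert_curve idx (p t) (t n)))"
      by (intro smoothD[OF X] smooth_plot_pert_curve smooth_plot_coord smooth_plot_weaken[OF p]) simp_all
  next
    fix s t :: "nat \<Rightarrow> real" assume st: "\<And>i. i < n \<Longrightarrow> s i = t i"
    show "(\<lambda>\<epsilon>. X (pert_curve idx (p s) \<epsilon>)) = (\<lambda>\<epsilon>. X (pert_curve idx (p t) \<epsilon>))"
      using smooth_plot_cong[OF p st] by simp
  qed
qed

text \<open>\<open>pert_curve\<close> is linear in its tuple, so variation of \<open>\<eta>\<close>
  along \<open>S\<close> varies the base curve along \<open>pert_curve idx S\<close>. The explicit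
  argument \<open>\<epsilon>\<close> of \<open>X\<close> leaves room for a frozen tuple of
  covectors, whose cocurve still depends on \<open>\<epsilon>\<close>.\<close>

lemma has_curve_deriv_taylor_coeff_pert_curve:
  assumes X: "smooth (\<lambda>(v, \<epsilon>). X v \<epsilon>)"
  shows "has_curve_deriv (\<lambda>s. taylor_coeff k (\<lambda>\<epsilon>. X (pert_curve idx (\<eta> + s *\<^sub>R S) \<epsilon>) \<epsilon>))
    (taylor_coeff k (\<lambda>\<epsilon>. gateaux (\<lambda>v. X v \<epsilon>) (pert_curve idx \<eta> \<epsilon>) (pert_curve idx S \<epsilon>))) 0"
proof -
  have "smooth_plot 2 (\<lambda>t. X (pert_curve idx (\<eta> + t 0 *\<^sub>R S) (t 1)) (t 1))"
    by (intro smoothD2[OF X] smooth_plot_pert_curve smooth_plot_add smooth_plot_scaleR smooth_plot_const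
        smooth_plot_coord) simp_all
  from has_curve_deriv_taylor_coeff[where f = "\<lambda>s \<epsilon>. X (pert_curve idx (\<eta> + s *\<^sub>R S) \<epsilon>) \<epsilon>", OF this, of k 0]
  show ?thesis
    by (simp add: gateaux_def pert_curve_add_scaleR)
qed

lemma is_variational_derivative_const:
  assumes "is_variational_derivative B H G"
  shows "B (G u) S = gateaux H u S"
  using assms smooth_const[of S] unfolding is_variational_derivative_def by blast

section \<open>Pairing, operator and functional as Taylor coefficients\<close>

locale perturbation =
  fixes B :: "'d::locally_convex_space \<Rightarrow> 'e::locally_convex_space \<Rightarrow> real"
    and N :: nat and idx :: "'n::finite \<Rightarrow> nat"
  assumes pairing: "duality_pairing B" and idx: "bij_betw idx UNIV {0..N}"
begin

lemma linear_pairing: "linear (\<lambda>\<alpha>. B \<alpha> x)" "linear (B \<alpha>)"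
  using pairing by (auto simp: duality_pairing_def bilinear_def)

lemma smooth_pairing: "smooth (\<lambda>(\<alpha>, x). B \<alpha> x)"
  using pairing by (simp add: duality_pairing_def)

lemma pairing_left_eqI:
  assumes "\<And>x. B \<alpha> x = B \<beta> x"
  shows "\<alpha> = \<beta>"
proof -
  have "B (\<alpha> - \<beta>) x = 0" for x
    using linear_diff[OF linear_pairing(1)] assms by simp
  then show ?thesis using pairing unfolding duality_pairing_def by (metis eq_iff_diff_eq_0)
qed

lemma variational_derivative_eq:
  assumes "is_variational_derivative B H G"
  shows "variational_derivative B H = G"
  unfolding variational_derivative_def
proof (rule the_equality)
  fix G' assume "is_variational_derivative B H G'"
  from is_variational_derivative_const[OF this] show "G' = G"
    by (intro ext pairing_left_eqI) (simp add: is_variational_derivative_const[OF assms])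
qed fact

lemma idx_le: "idx i \<le> N"
  using idx by (auto simp: bij_betw_def)

lemma idx_eq_iff: "idx i = idx j \<longleftrightarrow> i = j"
  using idx by (auto simp: bij_betw_def inj_eq)

lemma sum_idx: "(\<Sum>i\<in>UNIV. f (idx i)) = (\<Sum>b\<le>N. f b)"
  using sum.reindex_bij_betw[OF idx] by (simp add: atLeast0AtMost)

lemma taylor_coeff_pert_curve: "taylor_coeff (idx j) (pert_curve idx \<eta>) = \<eta> $ j"
proof -
  have "taylor_coeff (idx j) (\<lambda>\<epsilon>. \<epsilon> ^ idx i *\<^sub>R \<eta> $ i) = (if i = j then \<eta> $ i else 0)" for i
    using idx_eq_iff[of i j] by (auto simp: taylor_coeff_power_scaleR smooth_curve_const taylor_coeff_const)
  then show ?thesis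
    by (simp add: pert_curve_def[abs_def] taylor_coeff_sum smooth_curve_power_scaleR smooth_curve_const)
qed

lemma taylor_coeff_pert_cocurve: "taylor_coeff (N - idx j) (pert_cocurve N idx \<beta>) = \<beta> $ j"
proof -
  have "taylor_coeff (N - idx j) (\<lambda>\<epsilon>. \<epsilon> ^ (N - idx i) *\<^sub>R \<beta> $ i) = (if i = j then \<beta> $ i else 0)" for i
    using idx_eq_iff[of i j] idx_le[of i] idx_le[of j]
    by (auto simp: taylor_coeff_power_scaleR smooth_curve_const taylor_coeff_const)
  then show ?thesis
    by (simp add: pert_cocurve_def[abs_def] taylor_coeff_sum smooth_curve_power_scaleR smooth_curve_const)
qed

lemma pert_pairing_eq_taylor_coeff:
  assumes a: "smooth_curve a" "\<And>i. taylor_coeff (N - idx i) a = \<alpha> $ i"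
    and c: "smooth_curve c" "\<And>i. taylor_coeff (idx i) c = x $ i"
  shows "pert_pairing B \<alpha> x = taylor_coeff N (\<lambda>\<epsilon>. B (a \<epsilon>) (c \<epsilon>))"
proof -
  have "taylor_coeff N (\<lambda>\<epsilon>. B (a \<epsilon>) (c \<epsilon>)) = (\<Sum>b\<le>N. taylor_coeff (N - b) (\<lambda>\<epsilon>. B (a \<epsilon>) (taylor_coeff b c)))"
    by (intro taylor_coeff_linear_family[where L = "\<lambda>\<epsilon>. B (a \<epsilon>)"] c(1) linear_pairing(2)
        smooth_curve_compose2[OF smooth_pairing] a(1))
  also have "\<dots> = (\<Sum>b\<le>N. B (taylor_coeff (N - b) a) (taylor_coeff b c))"
    by (intro sum.cong refl taylor_coeff_linear[where L = "\<lambda>\<alpha>. B \<alpha> y" for y] a(1) linear_pairing(1)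
        smooth_curve_compose2[OF smooth_pairing] smooth_curve_const)
  also have "\<dots> = (\<Sum>i\<in>UNIV. B (taylor_coeff (N - idx i) a) (taylor_coeff (idx i) c))"
    by (rule sum_idx[symmetric])
  finally show ?thesis
    by (simp add: pert_pairing_def a(2) c(2))
qed

lemma pert_operator_eq_taylor_coeff:
  assumes lin: "\<And>u. linear (J u)" and J: "smooth (\<lambda>(u, \<beta>). J u \<beta>)"
    and b: "smooth_curve b" "\<And>j. taylor_coeff (N - idx j) b = \<beta> $ j"
  shows "pert_operator N idx J \<eta> \<beta> $ i = taylor_coeff (idx i) (\<lambda>\<epsilon>. J (pert_curve idx \<eta> \<epsilon>) (b \<epsilon>))"
proof -
  let ?T = "\<lambda>m k. taylor_coeff k (\<lambda>\<epsilon>. J (pert_curve idx \<eta> \<epsilon>) (taylor_coeff m b))"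
  have "taylor_coeff (idx i) (\<lambda>\<epsilon>. J (pert_curve idx \<eta> \<epsilon>) (b \<epsilon>)) = (\<Sum>m\<le>idx i. ?T m (idx i - m))"
    by (intro taylor_coeff_linear_family[where L = "\<lambda>\<epsilon>. J (pert_curve idx \<eta> \<epsilon>)"] b(1) lin
        smooth_curve_compose2[OF J] smooth_curve_pert_curve)
  also have "\<dots> = (\<Sum>m\<le>N. if idx i < m then 0 else ?T m (idx i - m))"
    using idx_le[of i] by (intro sum.mono_neutral_cong_left) auto
  \<comment> \<open>Reversing the order of summation matches the downward numbering of covectors;
    the vanishing terms become the zero blocks of the operator.\<close>
  also have "\<dots> = (\<Sum>k\<le>N. if idx i < N - k then 0 else ?T (N - k) (idx i - (N - k)))"
    by (rule sum.reindex_bij_witness[where i = "\<lambda>k. N - k" and j = "\<lambda>k. N - k"]) auto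
  also have "\<dots> = (\<Sum>j\<in>UNIV. if idx i < N - idx j then 0 else ?T (N - idx j) (idx i - (N - idx j)))"
    by (rule sum_idx[symmetric])
  also have "\<dots> = pert_operator N idx J \<eta> \<beta> $ i"
    unfolding pert_operator_def pert_block_def
    using idx_le by (auto simp: b(2) intro!: sum.cong)
  finally show ?thesis ..
qed

text \<open>Along the base curve, \<open>G\<close> paired with \<open>S\<close> is the Gateaux
  derivative of \<open>H\<close>, and taking the coefficient of order \<open>N\<close> commutes with
  that derivative. Uniqueness follows from nondegeneracy of \<open>B\<close> in each
  component.\<close>

lemma variational_derivative_pert_functional:
  assumes H: "smooth H" and G: "is_variational_derivative B H G"
  shows "is_variational_derivative (pert_pairing B) (pert_functional N idx H) (pert_gradient N idx G)"
    "variational_derivative (pert_pairing B) (pert_functional N idx H) = pert_gradient N idx G"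
    "pert_functional N idx H \<in> smooth_functionals (pert_pairing B :: 'd ^ 'n \<Rightarrow> 'e ^ 'n \<Rightarrow> real)"
proof -
  have smooth_G: "smooth G" using G by (simp add: is_variational_derivative_def)
  have "pert_pairing B (pert_gradient N idx G \<eta>) S = gateaux (pert_functional N idx H) \<eta> S" for \<eta> S :: "'e ^ 'n"
  proof -
    have "pert_pairing B (pert_gradient N idx G \<eta>) S =
        taylor_coeff N (\<lambda>\<epsilon>. B (G (pert_curve idx \<eta> \<epsilon>)) (pert_curve idx S \<epsilon>))"
      by (intro pert_pairing_eq_taylor_coeff smooth_curve_compose[OF smooth_G] smooth_curve_pert_curve
          taylor_coeff_pert_curve) (simp add: pert_gradient_def)
    also have "\<dots> = taylor_coeff N (\<lambda>\<epsilon>. gateaux H (pert_curve idx \<eta> \<epsilon>) (pert_curve idx S \<epsilon>))"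
      by (simp only: is_variational_derivative_const[OF G])
    also have "\<dots> = gateaux (pert_functional N idx H) \<eta> S"
    proof -
      \<comment> \<open>\<open>H\<close> receives a dummy parameter to fit the differentiation rule
        for families depending on \<open>\<epsilon>\<close>.\<close>
      have "smooth (\<lambda>(v, \<epsilon>::real). H v)"
        using H unfolding smooth_def comp_def by (auto simp: case_prod_unfold dest: smooth_plot_fst)
      from has_curve_deriv_taylor_coeff_pert_curve[OF this, of N idx \<eta> S]
      show ?thesis
        unfolding gateaux_def[of "pert_functional N idx H"] pert_functional_def
        by (rule has_curve_deriv_imp_curve_deriv[symmetric])
    qed
    finally show ?thesis .
  qed
  moreover have "smooth (pert_gradient N idx G :: 'e ^ 'n \<Rightarrow> 'd ^ 'n)"
    unfolding smooth_def comp_def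
    by (intro allI impI smooth_plot_vec)
      (simp add: pert_gradient_def smoothD[OF smooth_taylor_coeff_pert_curve[OF smooth_G]])
  ultimately show *: "is_variational_derivative (pert_pairing B) (pert_functional N idx H) (pert_gradient N idx G)"
    unfolding is_variational_derivative_def by blast
  show "variational_derivative (pert_pairing B) (pert_functional N idx H) = pert_gradient N idx G"
    unfolding variational_derivative_def
  proof (rule the_equality)
    show "is_variational_derivative (pert_pairing B) (pert_functional N idx H) (pert_gradient N idx G)"
      by (rule *)
  next
    fix G' :: "'e ^ 'n \<Rightarrow> 'd ^ 'n"
    assume G': "is_variational_derivative (pert_pairing B) (pert_functional N idx H) G'"
    show "G' = pert_gradient N idx G"
    proof
      fix \<eta>
      \<comment> \<open>Tuples supported in a single component reduce the comparison of gradients to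
        the pairing \<open>B\<close>.\<close>
      have axis: "pert_pairing B \<alpha> (\<chi> j. if j = i then x else 0) = B (\<alpha> $ i) x" for \<alpha> i x
      proof -
        have "pert_pairing B \<alpha> (\<chi> j. if j = i then x else 0) = (\<Sum>j\<in>UNIV. if j = i then B (\<alpha> $ j) x else 0)"
          unfolding pert_pairing_def by (intro sum.cong) (auto simp: linear_0[OF linear_pairing(2)])
        then show ?thesis by simp
      qed
      have "B (G' \<eta> $ i) x = B (pert_gradient N idx G \<eta> $ i) x" for i x
        using is_variational_derivative_const[OF G', of \<eta> "\<chi> j. if j = i then x else 0"]
          is_variational_derivative_const[OF *, of \<eta> "\<chi> j. if j = i then x else 0"]
        by (simp add: axis)
      then show "G' \<eta> = pert_gradient N idx G \<eta>"
        by (simp add: vec_eq_iff pairing_left_eqI)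
    qed
  qed
  show "pert_functional N idx H \<in> smooth_functionals (pert_pairing B :: 'd ^ 'n \<Rightarrow> 'e ^ 'n \<Rightarrow> real)"
    using * smooth_taylor_coeff_pert_curve[OF H, of N idx]
    unfolding smooth_functionals_def pert_functional_def[abs_def] by blast
qed

lemma pert_functional_smooth_functionals:
  assumes "H \<in> smooth_functionals B"
  shows "is_variational_derivative B H (variational_derivative B H)"
    "variational_derivative (pert_pairing B) (pert_functional N idx H) =
      pert_gradient N idx (variational_derivative B H)"
    "pert_functional N idx H \<in> smooth_functionals (pert_pairing B :: 'd ^ 'n \<Rightarrow> 'e ^ 'n \<Rightarrow> real)"
proof -
  from assms obtain G where G: "smooth H" "is_variational_derivative B H G"
    by (auto simp: smooth_functionals_def)
  show "is_variational_derivative B H (variational_derivative B H)"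
    "variational_derivative (pert_pairing B) (pert_functional N idx H) =
      pert_gradient N idx (variational_derivative B H)"
    "pert_functional N idx H \<in> smooth_functionals (pert_pairing B :: 'd ^ 'n \<Rightarrow> 'e ^ 'n \<Rightarrow> real)"
    using variational_derivative_pert_functional[OF G] G(2) by (simp_all add: variational_derivative_eq[OF G(2)])
qed

section \<open>Linearity, smoothness and Jacobi terms of perturbed operators\<close>

context
  fixes J :: "'e \<Rightarrow> 'd \<Rightarrow> 'e"
  assumes lin: "\<And>u. linear (J u)" and J: "smooth (\<lambda>(u, \<beta>). J u \<beta>)"
begin

lemma pert_operator_cocurve:
  "pert_operator N idx J \<eta> \<beta> $ i =
    taylor_coeff (idx i) (\<lambda>\<epsilon>. J (pert_curve idx \<eta> \<epsilon>) (pert_cocurve N idx \<beta> \<epsilon>))"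
  by (intro pert_operator_eq_taylor_coeff lin J smooth_curve_pert_cocurve taylor_coeff_pert_cocurve)

lemma smooth_curve_operator: "smooth_curve b \<Longrightarrow> smooth_curve (\<lambda>\<epsilon>. J (pert_curve idx \<eta> \<epsilon>) (b \<epsilon>))"
  by (intro smooth_curve_compose2[OF J] smooth_curve_pert_curve)

lemma linear_pert_operator: "linear (pert_operator N idx J \<eta>)"
proof (rule linearI)
  fix \<beta> \<gamma> :: "'d ^ 'n" and r :: real
  show "pert_operator N idx J \<eta> (\<beta> + \<gamma>) = pert_operator N idx J \<eta> \<beta> + pert_operator N idx J \<eta> \<gamma>"
    by (simp add: vec_eq_iff pert_operator_cocurve linear_add[OF linear_pert_cocurve] linear_add[OF lin]
        taylor_coeff_add smooth_curve_operator smooth_curve_pert_cocurve)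
  show "pert_operator N idx J \<eta> (r *\<^sub>R \<beta>) = r *\<^sub>R pert_operator N idx J \<eta> \<beta>"
    by (simp add: vec_eq_iff pert_operator_cocurve linear_scale[OF linear_pert_cocurve] linear_scale[OF lin]
        taylor_coeff_scaleR smooth_curve_operator smooth_curve_pert_cocurve)
qed

lemma smooth_pert_operator: "smooth (\<lambda>(\<eta>, \<beta>). pert_operator N idx J \<eta> \<beta>)"
  unfolding smooth_def comp_def
proof (intro allI impI smooth_plot_vec)
  fix n i and p :: "_ \<Rightarrow> ('e ^ 'n) \<times> ('d ^ 'n)" assume p: "smooth_plot n p"
  show "smooth_plot n (\<lambda>t. (case p t of (\<eta>, \<beta>) \<Rightarrow> pert_operator N idx J \<eta> \<beta>) $ i)"
    unfolding case_prod_unfold pert_operator_cocurve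
    by (intro smooth_plot_taylor_coeff_pert J smooth_plot_fst smooth_plot_snd p)
qed

lemma pert_pairing_pert_operator:
  "pert_pairing B \<alpha> (pert_operator N idx J \<eta> \<beta>) =
    taylor_coeff N (\<lambda>\<epsilon>. B (pert_cocurve N idx \<alpha> \<epsilon>) (J (pert_curve idx \<eta> \<epsilon>) (pert_cocurve N idx \<beta> \<epsilon>)))"
  by (intro pert_pairing_eq_taylor_coeff smooth_curve_pert_cocurve taylor_coeff_pert_cocurve
      smooth_curve_operator pert_operator_cocurve[symmetric])

lemma gateaux_pert_operator:
  "gateaux (\<lambda>\<zeta>. pert_operator N idx J \<zeta> \<gamma>) \<eta> S $ i =
    taylor_coeff (idx i)
      (\<lambda>\<epsilon>. gateaux (\<lambda>v. J v (pert_cocurve N idx \<gamma> \<epsilon>)) (pert_curve idx \<eta> \<epsilon>) (pert_curve idx S \<epsilon>))"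
proof -
  have X: "smooth (\<lambda>(v, \<epsilon>). J v (pert_cocurve N idx \<gamma> \<epsilon>))"
    unfolding smooth_def comp_def case_prod_unfold
    by (intro allI impI smoothD2[OF J] smooth_plot_pert_cocurve smooth_plot_const smooth_plot_fst smooth_plot_snd)
  have "has_curve_deriv (\<lambda>s. pert_operator N idx J (\<eta> + s *\<^sub>R S) \<gamma>)
     (\<chi> i. taylor_coeff (idx i)
      (\<lambda>\<epsilon>. gateaux (\<lambda>v. J v (pert_cocurve N idx \<gamma> \<epsilon>)) (pert_curve idx \<eta> \<epsilon>) (pert_curve idx S \<epsilon>))) 0"
    using has_curve_deriv_taylor_coeff_pert_curve[OF X]
    by (intro has_curve_deriv_vec) (simp add: pert_operator_cocurve)
  then show ?thesis
    by (simp add: gateaux_def[of "\<lambda>\<zeta>. pert_operator N idx J \<zeta> \<gamma>"] has_curve_deriv_imp_curve_deriv)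
qed

text \<open>
  The direction \<open>pert_operator N idx J \<eta> (\<beta> \<eta>)\<close> only agrees with the curve \<open>J(u)\<beta>\<close> up to order \<open>N\<close>;
  since the Gateaux derivative is linear in the direction, the difference does not reach the
  \<open>N\<close>-th Taylor coefficient.
\<close>

lemma jacobi_term_pert_operator:
  "jacobi_term (pert_pairing B) (pert_operator N idx J) \<alpha> \<beta> \<gamma> \<eta> =
    taylor_coeff N (\<lambda>\<epsilon>. jacobi_term B J (\<lambda>_. pert_cocurve N idx (\<alpha> \<eta>) \<epsilon>) (\<lambda>_. pert_cocurve N idx (\<beta> \<eta>) \<epsilon>)
      (\<lambda>_. pert_cocurve N idx (\<gamma> \<eta>) \<epsilon>) (pert_curve idx \<eta> \<epsilon>))"
  "smooth_curve (\<lambda>\<epsilon>. jacobi_term B J (\<lambda>_. pert_cocurve N idx (\<alpha> \<eta>) \<epsilon>) (\<lambda>_. pert_cocurve N idx (\<beta> \<eta>) \<epsilon>)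
      (\<lambda>_. pert_cocurve N idx (\<gamma> \<eta>) \<epsilon>) (pert_curve idx \<eta> \<epsilon>))"
proof -
  define u where "u = pert_curve idx \<eta>"
  define a where "a = pert_cocurve N idx (\<alpha> \<eta>)"
  define b where "b = pert_cocurve N idx (\<beta> \<eta>)"
  define S where "S = pert_operator N idx J \<eta> (\<beta> \<eta>)"
  define D where "D \<epsilon> = gateaux (\<lambda>v. J v (pert_cocurve N idx (\<gamma> \<eta>) \<epsilon>)) (u \<epsilon>)" for \<epsilon>
  have curves: "smooth_curve u" "smooth_curve a" "smooth_curve b" "smooth_curve (pert_curve idx S)"
    by (simp_all add: u_def a_def b_def smooth_curve_pert_curve smooth_curve_pert_cocurve)
  have X: "smooth (\<lambda>(v, \<epsilon>). J v (pert_cocurve N idx (\<gamma> \<eta>) \<epsilon>))"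
    unfolding smooth_def comp_def case_prod_unfold
    by (intro allI impI smoothD2[OF J] smooth_plot_pert_cocurve smooth_plot_const smooth_plot_fst smooth_plot_snd)
  have D: "smooth_curve (\<lambda>\<epsilon>. D \<epsilon> (r \<epsilon>))" if "smooth_curve r" for r
    unfolding D_def by (intro smooth_curve_gateaux[OF X] curves that)
  have lin_D: "linear (D \<epsilon>)" for \<epsilon>
    unfolding D_def by (intro linear_gateaux smooth_fix_param[OF J])
  have Jb: "smooth_curve (\<lambda>\<epsilon>. J (u \<epsilon>) (b \<epsilon>))"
    by (intro smooth_curve_compose2[OF J] curves)
  have "taylor_coeff k (pert_curve idx S) = taylor_coeff k (\<lambda>\<epsilon>. J (u \<epsilon>) (b \<epsilon>))" if "k \<le> N" for k
  proof -
    have "k \<in> idx ` UNIV"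
      using idx that by (simp add: bij_betw_def)
    then obtain i where "k = idx i" by blast
    then show ?thesis
      by (simp add: taylor_coeff_pert_curve S_def pert_operator_cocurve u_def b_def)
  qed
  \<comment> \<open>The two directions agree up to order \<open>N\<close> and enter through a linear
    family, so one may replace the other.\<close>
  then have "taylor_coeff N (\<lambda>\<epsilon>. B (a \<epsilon>) (D \<epsilon> (pert_curve idx S \<epsilon>))) =
      taylor_coeff N (\<lambda>\<epsilon>. B (a \<epsilon>) (D \<epsilon> (J (u \<epsilon>) (b \<epsilon>))))"
    by (intro taylor_coeff_linear_cong[where L = "\<lambda>\<epsilon> x. B (a \<epsilon>) (D \<epsilon> x)"] curves Jb
        linear_compose[OF lin_D linear_pairing(2), unfolded comp_def] smooth_curve_compose2[OF smooth_pairing] D)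
  moreover have "pert_pairing B (\<alpha> \<eta>) (gateaux (\<lambda>\<zeta>. pert_operator N idx J \<zeta> (\<gamma> \<eta>)) \<eta> S) =
      taylor_coeff N (\<lambda>\<epsilon>. B (a \<epsilon>) (D \<epsilon> (pert_curve idx S \<epsilon>)))"
    by (intro pert_pairing_eq_taylor_coeff curves D)
      (simp_all add: a_def D_def u_def taylor_coeff_pert_cocurve gateaux_pert_operator)
  ultimately show "jacobi_term (pert_pairing B) (pert_operator N idx J) \<alpha> \<beta> \<gamma> \<eta> =
    taylor_coeff N (\<lambda>\<epsilon>. jacobi_term B J (\<lambda>_. pert_cocurve N idx (\<alpha> \<eta>) \<epsilon>) (\<lambda>_. pert_cocurve N idx (\<beta> \<eta>) \<epsilon>)
      (\<lambda>_. pert_cocurve N idx (\<gamma> \<eta>) \<epsilon>) (pert_curve idx \<eta> \<epsilon>))"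
    by (simp add: jacobi_term_def a_def b_def u_def D_def S_def)
  show "smooth_curve (\<lambda>\<epsilon>. jacobi_term B J (\<lambda>_. pert_cocurve N idx (\<alpha> \<eta>) \<epsilon>) (\<lambda>_. pert_cocurve N idx (\<beta> \<eta>) \<epsilon>)
      (\<lambda>_. pert_cocurve N idx (\<gamma> \<eta>) \<epsilon>) (pert_curve idx \<eta> \<epsilon>))"
    using smooth_curve_compose2[OF smooth_pairing curves(2) D[OF Jb]]
    by (simp add: jacobi_term_def a_def b_def u_def D_def)
qed

end

section \<open>Transfer of operators, structures, brackets and pairs\<close>

lemma hamiltonian_operator_pert_operator:
  assumes "hamiltonian_operator B J"
  shows "hamiltonian_operator (pert_pairing B) (pert_operator N idx J)"
proof -
  \<comment> \<open>Constant fields suffice, because for each \<open>\<epsilon>\<close> the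
    identities of \<open>J\<close> are applied at one point to single covectors.\<close>
  have lin: "\<And>u. linear (J u)" and J: "smooth (\<lambda>(u, \<beta>). J u \<beta>)"
    and skew: "B a (J u b) = - B b (J u a)"
    and jacobi: "jacobi_term B J (\<lambda>_. a) (\<lambda>_. b) (\<lambda>_. c) u + jacobi_term B J (\<lambda>_. b) (\<lambda>_. c) (\<lambda>_. a) u +
      jacobi_term B J (\<lambda>_. c) (\<lambda>_. a) (\<lambda>_. b) u = 0" for a b c u
    using assms smooth_const[where 'a = 'e] unfolding hamiltonian_operator_def by blast+
  note JJ = lin J
  show ?thesis
    unfolding hamiltonian_operator_def
  proof (intro conjI allI impI linear_pert_operator[OF JJ] smooth_pert_operator[OF JJ])
    fix \<alpha> \<beta> \<gamma> :: "'e ^ 'n \<Rightarrow> 'd ^ 'n" and \<eta>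
    let ?B = "\<lambda>\<alpha> \<beta> \<epsilon>. B (pert_cocurve N idx (\<alpha> \<eta>) \<epsilon>) (J (pert_curve idx \<eta> \<epsilon>) (pert_cocurve N idx (\<beta> \<eta>) \<epsilon>))"
    have "?B \<alpha> \<beta> = (\<lambda>\<epsilon>. (-1) *\<^sub>R ?B \<beta> \<alpha> \<epsilon>)"
      by (rule ext, subst skew) simp
    moreover have "smooth_curve (?B \<beta> \<alpha>)"
      by (intro smooth_curve_compose2[OF smooth_pairing] smooth_curve_pert_cocurve smooth_curve_operator[OF JJ])
    ultimately show "pert_pairing B (\<alpha> \<eta>) (pert_operator N idx J \<eta> (\<beta> \<eta>)) =
        - pert_pairing B (\<beta> \<eta>) (pert_operator N idx J \<eta> (\<alpha> \<eta>))"
      using taylor_coeff_scaleR[of "?B \<beta> \<alpha>" N "-1"] by (simp add: pert_pairing_pert_operator[OF JJ])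
    let ?j = "\<lambda>\<alpha> \<beta> \<gamma> \<epsilon>. jacobi_term B J (\<lambda>_. pert_cocurve N idx (\<alpha> \<eta>) \<epsilon>) (\<lambda>_. pert_cocurve N idx (\<beta> \<eta>) \<epsilon>)
      (\<lambda>_. pert_cocurve N idx (\<gamma> \<eta>) \<epsilon>) (pert_curve idx \<eta> \<epsilon>)"
    note j = jacobi_term_pert_operator[OF JJ]
    have "taylor_coeff N (?j \<alpha> \<beta> \<gamma>) + taylor_coeff N (?j \<beta> \<gamma> \<alpha>) + taylor_coeff N (?j \<gamma> \<alpha> \<beta>) =
        taylor_coeff N (\<lambda>\<epsilon>. ?j \<alpha> \<beta> \<gamma> \<epsilon> + ?j \<beta> \<gamma> \<alpha> \<epsilon> + ?j \<gamma> \<alpha> \<beta> \<epsilon>)"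
      by (subst taylor_coeff_add, intro smooth_curve_add j(2), rule j(2), subst taylor_coeff_add)
        (intro j(2) refl)+
    also have "\<dots> = 0"
      by (simp add: jacobi taylor_coeff_const)
    finally show "jacobi_term (pert_pairing B) (pert_operator N idx J) \<alpha> \<beta> \<gamma> \<eta> +
        jacobi_term (pert_pairing B) (pert_operator N idx J) \<beta> \<gamma> \<alpha> \<eta> +
        jacobi_term (pert_pairing B) (pert_operator N idx J) \<gamma> \<alpha> \<beta> \<eta> = 0"
      by (simp add: j(1))
  qed
qed

lemma hamiltonian_operatorD:
  assumes "hamiltonian_operator B J"
  shows "linear (J u)" "smooth (\<lambda>(u, \<beta>). J u \<beta>)"
  using assms by (auto simp: hamiltonian_operator_def)

lemma hamiltonian_structureD:
  assumes "hamiltonian_structure B K J H"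
  shows "hamiltonian_operator B J" "H \<in> smooth_functionals B"
  using assms by (auto simp: hamiltonian_structure_def)

text \<open>The curve \<open>G\<close> along \<open>pert_curve\<close> has the components of
  \<open>pert_gradient\<close> as its coefficients in downward numbering, so it can replace the
  cocurve in the formula for the operator.\<close>

lemma pert_operator_pert_gradient:
  assumes J: "hamiltonian_operator B J" and G: "smooth G"
  shows "pert_operator N idx J \<eta> (pert_gradient N idx G \<eta>) =
    pert_field idx (\<lambda>u. J u (G u)) \<eta>"
  by (simp add: vec_eq_iff pert_field_def,
      intro allI pert_operator_eq_taylor_coeff hamiltonian_operatorD[OF J] smooth_curve_compose[OF G]
      smooth_curve_pert_curve)
    (simp add: pert_gradient_def)

lemma hamiltonian_structure_pert:
  assumes "hamiltonian_structure B K J H"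
  shows "hamiltonian_structure (pert_pairing B) (pert_field idx K) (pert_operator N idx J)
    (pert_functional N idx H :: 'e ^ 'n \<Rightarrow> real)"
proof -
  have J: "hamiltonian_operator B J" and H: "H \<in> smooth_functionals B"
    and K: "K = (\<lambda>u. J u (variational_derivative B H u))"
    using assms by (auto simp: hamiltonian_structure_def)
  have "smooth (variational_derivative B H)"
    using pert_functional_smooth_functionals(1)[OF H] by (simp add: is_variational_derivative_def)
  then show ?thesis
    unfolding hamiltonian_structure_def K
    by (simp add: hamiltonian_operator_pert_operator J pert_functional_smooth_functionals(2,3)[OF H]
        pert_operator_pert_gradient)
qed

text \<open>The pairing formula is applied to the first gradient and to \<open>J\<close> of the
  second gradient, both along \<open>pert_curve\<close>; the preceding identity supplies the
  coefficients of the latter.\<close>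

lemma poisson_bracket_pert:
  assumes J: "hamiltonian_operator B J" and H1: "H1 \<in> smooth_functionals B" and H2: "H2 \<in> smooth_functionals B"
  shows "poisson_bracket (pert_pairing B) (pert_operator N idx J)
      (pert_functional N idx H1) (pert_functional N idx H2) \<eta> =
    taylor_coeff N (\<lambda>\<epsilon>. poisson_bracket B J H1 H2 (pert_curve idx \<eta> \<epsilon>))"
proof -
  have G: "smooth (variational_derivative B H)" if "H \<in> smooth_functionals B" for H
    using pert_functional_smooth_functionals(1)[OF that] by (simp add: is_variational_derivative_def)
  show ?thesis
    unfolding poisson_bracket_def pert_functional_smooth_functionals(2)[OF H1]
      pert_functional_smooth_functionals(2)[OF H2] pert_operator_pert_gradient[OF J G[OF H2]]
    by (intro pert_pairing_eq_taylor_coeff smooth_curve_compose[OF G[OF H1]] smooth_curve_pert_curve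
        smooth_curve_operator[OF hamiltonian_operatorD[OF J]] smooth_curve_compose[OF G[OF H2]])
      (simp_all add: pert_gradient_def pert_field_def)
qed

text \<open>Taylor coefficients are linear, so perturbing \<open>J + c J'\<close> gives the same
  combination of the perturbed operators; transfer of a single Hamiltonian operator then
  applies.\<close>

lemma hamiltonian_pair_pert:
  assumes J: "hamiltonian_operator B J" and J': "hamiltonian_operator B J'" and pair: "hamiltonian_pair B J J'"
  shows "hamiltonian_pair (pert_pairing B) (pert_operator N idx J) (pert_operator N idx J')"
  unfolding hamiltonian_pair_def
proof
  fix c :: real
  have C: "hamiltonian_operator B (\<lambda>u \<beta>. J u \<beta> + c *\<^sub>R J' u \<beta>)"
    using pair by (simp add: hamiltonian_pair_def)
  note D = hamiltonian_operatorD[OF J] and D' = hamiltonian_operatorD[OF J'] and DC = hamiltonian_operatorD[OF C]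
  have "smooth_curve (\<lambda>\<epsilon>. c *\<^sub>R J' (pert_curve idx \<eta> \<epsilon>) (pert_cocurve N idx \<beta> \<epsilon>))" for \<eta> \<beta>
    by (intro smooth_curve_scaleR smooth_curve_const smooth_curve_operator[OF D'] smooth_curve_pert_cocurve)
  then have "pert_operator N idx (\<lambda>u \<beta>. J u \<beta> + c *\<^sub>R J' u \<beta>) =
      (\<lambda>\<eta> \<beta>. pert_operator N idx J \<eta> \<beta> + c *\<^sub>R pert_operator N idx J' \<eta> \<beta>)"
    by (simp add: fun_eq_iff vec_eq_iff pert_operator_cocurve[OF D] pert_operator_cocurve[OF D']
        pert_operator_cocurve[OF DC] taylor_coeff_add taylor_coeff_scaleR smooth_curve_operator[OF D]
        smooth_curve_operator[OF D'] smooth_curve_pert_cocurve)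
  then show "hamiltonian_operator (pert_pairing B)
      (\<lambda>\<eta> \<beta>. pert_operator N idx J \<eta> \<beta> + c *\<^sub>R pert_operator N idx J' \<eta> \<beta>)"
    using hamiltonian_operator_pert_operator[OF C] by simp
qed

end

theorem theorem3p5:
  fixes B :: "'d::locally_convex_space \<Rightarrow> 'e::locally_convex_space \<Rightarrow> real"
    and K :: "'e \<Rightarrow> 'e"
    and N :: nat
    and idx :: "'n::finite \<Rightarrow> nat"
  assumes "duality_pairing B"
    and "smooth K"
    and "N \<ge> 1"
    and "bij_betw idx UNIV {0..N}"
  shows "(\<forall>(J :: 'e \<Rightarrow> 'd \<Rightarrow> 'e) (H :: 'e \<Rightarrow> real).
            hamiltonian_structure B K J H \<longrightarrow>
              hamiltonian_structure (pert_pairing B) (pert_field idx K)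
                (pert_operator N idx J) (pert_functional N idx H) \<and>
              (\<forall>H1 H2. H1 \<in> smooth_functionals B \<and> H2 \<in> smooth_functionals B \<longrightarrow>
                 pert_functional N idx H1 \<in> smooth_functionals (pert_pairing B :: 'd ^ 'n \<Rightarrow> 'e ^ 'n \<Rightarrow> real) \<and>
                 pert_functional N idx H2 \<in> smooth_functionals (pert_pairing B :: 'd ^ 'n \<Rightarrow> 'e ^ 'n \<Rightarrow> real) \<and>
                 (\<forall>\<eta> :: 'e ^ 'n.
                    poisson_bracket (pert_pairing B) (pert_operator N idx J)
                      (pert_functional N idx H1) (pert_functional N idx H2) \<eta> =
                    taylor_coeff N (\<lambda>\<epsilon>. poisson_bracket B J H1 H2 (pert_curve idx \<eta> \<epsilon>))))) \<and>
         (\<forall>(m :: nat) (J :: nat \<Rightarrow> 'e \<Rightarrow> 'd \<Rightarrow> 'e) (H :: nat \<Rightarrow> 'e \<Rightarrow> real).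
            multi_hamiltonian_structure B K m J H \<longrightarrow>
              multi_hamiltonian_structure (pert_pairing B) (pert_field idx K) m
                (\<lambda>k. pert_operator N idx (J k)) (\<lambda>k. pert_functional N idx (H k)))"
proof -
  interpret perturbation B N idx
    by unfold_locales fact+
  show ?thesis
  proof (intro conjI allI impI)
    fix J H assume *: "hamiltonian_structure B K J H"
    show "hamiltonian_structure (pert_pairing B) (pert_field idx K)
        (pert_operator N idx J) (pert_functional N idx H)"
      by (rule hamiltonian_structure_pert[OF *])
    fix H1 H2 assume "H1 \<in> smooth_functionals B \<and> H2 \<in> smooth_functionals B"
    then have H: "H1 \<in> smooth_functionals B" "H2 \<in> smooth_functionals B" by auto
    show "pert_functional N idx H1 \<in> smooth_functionals (pert_pairing B :: 'd ^ 'n \<Rightarrow> 'e ^ 'n \<Rightarrow> real)"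
      "pert_functional N idx H2 \<in> smooth_functionals (pert_pairing B :: 'd ^ 'n \<Rightarrow> 'e ^ 'n \<Rightarrow> real)"
      using pert_functional_smooth_functionals(3) H by auto
    show "poisson_bracket (pert_pairing B) (pert_operator N idx J)
        (pert_functional N idx H1) (pert_functional N idx H2) \<eta> =
        taylor_coeff N (\<lambda>\<epsilon>. poisson_bracket B J H1 H2 (pert_curve idx \<eta> \<epsilon>))" for \<eta> :: "'e ^ 'n"
      using * H by (intro poisson_bracket_pert) (simp_all add: hamiltonian_structure_def)
  next
    fix m J H assume "multi_hamiltonian_structure B K m J H"
    then show "multi_hamiltonian_structure (pert_pairing B) (pert_field idx K) m
        (\<lambda>k. pert_operator N idx (J k)) (\<lambda>k. pert_functional N idx (H k))"
      unfolding multi_hamiltonian_structure_def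
      using hamiltonian_structure_pert hamiltonian_pair_pert hamiltonian_structureD(1) by blast
  qed
qed

end
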